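(* Let $n\ge3$ be odd, let $\mathrm A>0$, and consider the system $$\ddot r_k=(1-|\dot r_k|^2)\dot r_k-\frac{\mathrm A^2}{n}\sum_{m=1}^n (r_k-r_m),\qquad k=1,\dots,n,\quad r_k(t)\in\mathbb C .$$ There exists $\eta>0$ such that small perturbations of rotating states converge to a nearby rotating state at rate $e^{-\eta t}$: there exists $\delta>0$ such that, for every $\mathrm R_0\in\mathbb C$ and all angles with $\sum_{k=1}^n e^{i\theta_{0,k}}=0$, every solution with $|r_k(0)-(\mathrm R_0+\frac1{\mathrm A}e^{i\theta_{0,k}})|<\delta$ and $|\dot r_k(0)-ie^{i\theta_{0,k}}|<\delta$ for all $k$ admits $\mathrm R_\infty\in\mathbb C$, angles $\theta_{\infty,k}$ with $\sum_{k=1}^n e^{i\theta_{\infty,k}}=0$, and a constant $K$ such that for all $k$ and $t\ge0$ $$\Big|r_k(t)-\big(\mathrm R_\infty+\tfrac1{\mathrm A}e^{i\theta_{\infty,k}}e^{i\mathrm At}\big)\Big|+\big|\dot r_k(t)-ie^{i\theta_{\infty,k}}e^{i\mathrm At}\big|\le K e^{-\eta t}.$$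
   Context: Planar vectors $r_k\in\mathbb R^2$ are identified with complex numbers. A rotating state is a solution of the form $r_k(t)=\frac1{\mathrm A}e^{i\mathrm At}e^{i\theta_{0,k}}+\mathrm R_0$ for all $t$ and $k$, where $\mathrm R_0\in\mathbb C$ is constant and $\sum_{k=1}^n e^{i\theta_{0,k}}=0$. *)

theory Defs
  imports "HOL-Analysis.Analysis"
begin

(* v k is the velocity of agent k. Derivatives are taken within {0..}, hence one-sided at t = 0;
   this determines v from r on {0..}. Only the indices 1, ..., n matter. *)
definition swarm_solution ::
    "nat \<Rightarrow> real \<Rightarrow> (nat \<Rightarrow> real \<Rightarrow> complex) \<Rightarrow> (nat \<Rightarrow> real \<Rightarrow> complex) \<Rightarrow> bool"
  where "swarm_solution n A r v \<longleftrightarrow>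
    (\<forall>k\<in>{1..n}. \<forall>t\<ge>0.
       (r k has_vector_derivative v k t) (at t within {0..}) \<and>
       (v k has_vector_derivative
          complex_of_real (1 - (cmod (v k t))\<^sup>2) * v k t
          - complex_of_real (A\<^sup>2 / real n) * (\<Sum>m=1..n. r k t - r m t))
         (at t within {0..}))"

definition balanced_angles :: "nat \<Rightarrow> (nat \<Rightarrow> real) \<Rightarrow> bool"
  where "balanced_angles n \<theta> \<longleftrightarrow> (\<Sum>k=1..n. cis (\<theta> k)) = 0"

definition rotating_pos :: "real \<Rightarrow> complex \<Rightarrow> (nat \<Rightarrow> real) \<Rightarrow> nat \<Rightarrow> real \<Rightarrow> complex"
  where "rotating_pos A R \<theta> k t = R + complex_of_real (1 / A) * cis (\<theta> k) * cis (A * t)"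

definition rotating_vel :: "real \<Rightarrow> (nat \<Rightarrow> real) \<Rightarrow> nat \<Rightarrow> real \<Rightarrow> complex"
  where "rotating_vel A \<theta> k t = \<i> * cis (\<theta> k) * cis (A * t)"

lemma has_vector_derivative_cis_mult:
  "((\<lambda>t. cis (A * t)) has_vector_derivative complex_of_real A * \<i> * cis (A * t)) (at t within S)"
proof -
  have "((\<lambda>t. cis (A * t)) has_derivative (\<lambda>h. (A * h) *\<^sub>R (\<i> * cis (A * t)))) (at t within S)"
    by (rule has_derivative_cis) (auto intro!: derivative_eq_intros)
  then show ?thesis
    by (simp add: has_vector_derivative_def scaleR_conv_of_real mult_ac)
qed

lemma rotating_state_is_solution:
  assumes "A > 0" "n \<ge> 1" "balanced_angles n \<theta>"
  shows "swarm_solution n A (rotating_pos A R \<theta>) (rotating_vel A \<theta>)"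
  unfolding swarm_solution_def
proof (intro ballI allI impI conjI)
  fix k t assume "k \<in> {1..n}" "(0::real) \<le> t"
  show "(rotating_pos A R \<theta> k has_vector_derivative rotating_vel A \<theta> k t) (at t within {0..})"
    unfolding rotating_pos_def[abs_def] rotating_vel_def
    by (rule derivative_eq_intros has_vector_derivative_cis_mult refl)+ (use assms in simp)
  have "(\<Sum>m=1..n. rotating_pos A R \<theta> k t - rotating_pos A R \<theta> m t)
      = of_nat n * (of_real (1 / A) * cis (\<theta> k) * cis (A * t))
        - of_real (1 / A) * (\<Sum>m=1..n. cis (\<theta> m)) * cis (A * t)"
    by (simp add: rotating_pos_def sum_subtractf sum_distrib_left sum_distrib_right)
  also have "\<dots> = of_nat n * (of_real (1 / A) * cis (\<theta> k) * cis (A * t))"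
    using assms by (simp add: balanced_angles_def)
  finally have sum_eq: "(\<Sum>m=1..n. rotating_pos A R \<theta> k t - rotating_pos A R \<theta> m t) = \<dots>" .
  have norm1: "cmod (rotating_vel A \<theta> k t) = 1"
    by (simp add: rotating_vel_def norm_mult)
  have der: "(rotating_vel A \<theta> k has_vector_derivative
      \<i> * cis (\<theta> k) * (of_real A * \<i> * cis (A * t))) (at t within {0..})"
    unfolding rotating_vel_def[abs_def]
    by (rule has_vector_derivative_mult_right has_vector_derivative_cis_mult)+
  have eq: "\<i> * cis (\<theta> k) * (of_real A * \<i> * cis (A * t)) =
      of_real (1 - (cmod (rotating_vel A \<theta> k t))\<^sup>2) * rotating_vel A \<theta> k t
      - of_real (A\<^sup>2 / real n) * (\<Sum>m=1..n. rotating_pos A R \<theta> k t - rotating_pos A R \<theta> m t)"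
    unfolding sum_eq norm1 using assms by (simp add: field_simps power2_eq_square)
  show "(rotating_vel A \<theta> k has_vector_derivative
      of_real (1 - (cmod (rotating_vel A \<theta> k t))\<^sup>2) * rotating_vel A \<theta> k t
      - of_real (A\<^sup>2 / real n) * (\<Sum>m=1..n. rotating_pos A R \<theta> k t - rotating_pos A R \<theta> m t))
      (at t within {0..})"
    using der unfolding eq .
qed

end

theory Submission
  imports Defs
begin

text \<open>
  In the rotating frame \<open>v k = \<i> e^(\<i>At) u k\<close>, \<open>r k - rbar = (1/A) e^(\<i>At) z k\<close>, with \<open>rbar\<close> the mean
  position and \<open>s k = u k - z k\<close>, the system becomes autonomous:
  \<open>u k' = - \<rho> k * u k - \<i>A s k\<close> and \<open>s k' = - \<rho> k * u k - 2\<i>A s k + \<i>A x\<close>,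
  where \<open>\<rho> k = |u k|^2 - 1\<close> and \<open>x\<close> is the mean of the \<open>s k\<close>. As the \<open>z k\<close> sum to zero, \<open>x\<close> is also
  the mean of the \<open>u k\<close>. The rotating states are exactly the states with all \<open>\<rho> k = 0\<close> and all
  \<open>s k = 0\<close>, so the sum of the \<open>(\<rho> k)^2 + |s k|^2\<close> measures the deviation from the whole family at
  once. If it decays exponentially then so do \<open>u k'\<close> and \<open>rbar' = \<i> e^(\<i>At) x\<close>; hence \<open>u k\<close> and \<open>rbar\<close>
  converge exponentially, the limits of the \<open>u k\<close> are unimodular with mean zero, and together they
  are the limiting rotating state.

  The decay comes from a quadratic Lyapunov function. Write \<open>cnj (u k) * s k = p + \<i>q\<close>,
  \<open>cnj (u k) * x = g + \<i>f\<close>, \<open>y = q - \<rho>/A\<close> and \<open>m = g - 2p\<close>. The sum \<open>W\<close> over the agents of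
  \<open>|s|^2/2 - |x|^2/4 + \<rho>^2/(4A^2) - \<rho>q/(2A)\<close> equals, up to cubic terms, one quarter of the sum of
  \<open>p^2 + y^2 + |s - x|^2\<close> (lemma \<open>lyap_sum_eq\<close>), and up to cubic terms its derivative is minus the sum of
  the \<open>y^2\<close>. The quadratic form \<open>W\<close> could degenerate only if all \<open>s k\<close> were equal to one \<open>x\<close>
  orthogonal to every \<open>u k\<close>, so that all \<open>u k\<close> would be parallel; an odd number of parallel unit
  vectors cannot sum to zero (lemma \<open>odd_balanced_noncollinear\<close>). This is where \<open>n\<close> odd is needed.

  The dissipation controls only \<open>y\<close>. Adding the small multiples \<open>- \<mu>^6 y m\<close>, \<open>- \<mu>^8 \<rho> g\<close> and
  \<open>\<mu>^10 m \<rho>\<close> produces dissipation in \<open>m\<close>, in \<open>g\<close> (hence in \<open>x\<close>, by noncollinearity) and in \<open>\<rho>\<close>,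
  while all new cross terms are of relative size \<open>\<mu>\<close>. What remains is cubic and is absorbed near the
  family (lemmas \<open>lyap_rate_sum_le\<close> and \<open>lyap_sum_bounds\<close>). All constants depend on \<open>n\<close> and \<open>A\<close> only,
  which makes \<open>\<eta>\<close> and \<open>\<delta>\<close> uniform over the family.
\<close>

section \<open>The Lyapunov density and its derivative\<close>

text \<open>The speed excess: it vanishes exactly on the unit circle.\<close>
definition excess :: "complex \<Rightarrow> real" where "excess u = (cmod u)\<^sup>2 - 1"

text \<open>The quantity \<open>y\<close>: to first order \<open>2A y\<close> is the time derivative of the speed excess.\<close>
definition skew :: "real \<Rightarrow> complex \<Rightarrow> complex \<Rightarrow> real"
  where "skew A u s = Im (cnj u * s) - excess u / A"

text \<open>The quantity \<open>m\<close>: to leading order \<open>y' = A m - 2 y\<close>.\<close>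
definition defect :: "complex \<Rightarrow> complex \<Rightarrow> complex \<Rightarrow> real"
  where "defect u s x = Re (cnj u * x) - 2 * Re (cnj u * s)"

text \<open>The contribution of one agent to the Lyapunov function. The first line sums to \<open>W\<close>; the other
  terms spread the dissipation. The separation of the exponents 6, 8, 10 is what makes every cross term in
  the derivative at most of relative size \<open>\<mu>\<close>.\<close>
definition lyap :: "real \<Rightarrow> real \<Rightarrow> complex \<Rightarrow> complex \<Rightarrow> complex \<Rightarrow> real"
  where "lyap A \<mu> u s x =
    (cmod s)\<^sup>2 / 2 - (cmod x)\<^sup>2 / 4 + (excess u)\<^sup>2 / (4 * A\<^sup>2) - excess u * Im (cnj u * s) / (2 * A)
    - \<mu> ^ 6 * (skew A u s * defect u s x) - \<mu> ^ 8 * (excess u * Re (cnj u * x))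
    + \<mu> ^ 10 * (defect u s x * excess u)"

text \<open>The quadratic remainder in the derivative of \<open>skew\<close>.\<close>
definition skew_err :: "real \<Rightarrow> complex \<Rightarrow> complex \<Rightarrow> real"
  where "skew_err A u s = - excess u * Im (cnj u * s) + A * (cmod s)\<^sup>2 + 2 * (excess u)\<^sup>2 / A"

text \<open>The linear part of the derivative of \<open>defect\<close>; \<open>B\<close> stands for the mean of the \<open>\<rho> k * u k\<close>.\<close>
definition defect_rate :: "real \<Rightarrow> complex \<Rightarrow> complex \<Rightarrow> complex \<Rightarrow> complex \<Rightarrow> real"
  where "defect_rate A u s x B = - 2 * excess u - 4 * A * skew A u s + 3 * A * Im (cnj u * x) - Re (cnj u * B)"

text \<open>The quadratic remainder in the derivative of \<open>defect\<close>.\<close>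
definition defect_err :: "real \<Rightarrow> complex \<Rightarrow> complex \<Rightarrow> complex \<Rightarrow> real"
  where "defect_err A u s x = - excess u * Re (cnj u * x) - A * Im (cnj s * x)
     + 2 * excess u * Re (cnj u * s) + 2 * (excess u)\<^sup>2"

lemma excess_alt: "excess w = Re w * Re w + Im w * Im w - 1"
  unfolding excess_def cmod_power2 by (simp add: power2_eq_square)

lemma has_real_derivative_Re: "(f has_vector_derivative D) (at t within S) \<Longrightarrow> ((\<lambda>t. Re (f t)) has_real_derivative Re D) (at t within S)"
  by (simp add: has_real_derivative_iff_has_vector_derivative bounded_linear.has_vector_derivative[OF bounded_linear_Re])

lemma has_real_derivative_Im: "(f has_vector_derivative D) (at t within S) \<Longrightarrow> ((\<lambda>t. Im (f t)) has_real_derivative Im D) (at t within S)"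
  by (simp add: has_real_derivative_iff_has_vector_derivative bounded_linear.has_vector_derivative[OF bounded_linear_Im])

lemma cnj_mult_deriv:
  assumes "(f has_vector_derivative D) (at t within S)" "(h has_vector_derivative E) (at t within S)"
  shows "((\<lambda>t. Re (cnj (f t) * h t)) has_real_derivative Re (cnj D * h t + cnj (f t) * E)) (at t within S)"
    and "((\<lambda>t. Im (cnj (f t) * h t)) has_real_derivative Im (cnj D * h t + cnj (f t) * E)) (at t within S)"
proof -
  have "((\<lambda>t. cnj (f t) * h t) has_vector_derivative cnj (f t) * E + cnj D * h t) (at t within S)"
    by (intro has_vector_derivative_mult has_vector_derivative_cnj assms)
  from has_real_derivative_Re[OF this] has_real_derivative_Im[OF this] 
  show "((\<lambda>t. Re (cnj (f t) * h t)) has_real_derivative Re (cnj D * h t + cnj (f t) * E)) (at t within S)"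
    and "((\<lambda>t. Im (cnj (f t) * h t)) has_real_derivative Im (cnj D * h t + cnj (f t) * E)) (at t within S)"
    by (simp_all add: add.commute)
qed

lemma excess_deriv:
  assumes u: "(u has_vector_derivative - complex_of_real (excess (u t)) * u t - \<i> * of_real A * s t) (at t within S)"
    and A: "A > 0"
  shows "((\<lambda>t. excess (u t)) has_real_derivative 2 * A * skew A (u t) (s t) - 2 * (excess (u t))\<^sup>2) (at t within S)"
proof -
  have e: "excess = (\<lambda>w. Re (cnj w * w) - 1)" 
    by (simp add: excess_alt fun_eq_iff)
  define r where "r = excess (u t)"
  define a where "a = Re (u t)"
  define b where "b = Im (u t)"
  have r: "r = a * a + b * b - 1" by (simp add: r_def a_def b_def excess_alt)
  have "((\<lambda>t. Re (cnj (u t) * u t) - 1) has_real_derivative 2 * A * skew A (u t) (s t) - 2 * (excess (u t))\<^sup>2) (at t within S)"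
    apply (rule DERIV_cong[OF DERIV_diff[OF cnj_mult_deriv(1)[OF u u] DERIV_const]])
    using A apply (simp add: skew_def flip: r_def a_def b_def)
    apply (simp add: r field_simps power2_eq_square)
    done
  then show ?thesis unfolding e .
qed

text \<open>The hypotheses on \<open>u\<close>, \<open>s\<close> and \<open>x\<close> here and below are the equations of motion of one agent in
  the rotating frame, at one time \<open>t\<close>.\<close>
lemma skew_deriv:
  assumes u: "(u has_vector_derivative - complex_of_real (excess (u t)) * u t - \<i> * of_real A * s t) (at t within S)"
    and s: "(s has_vector_derivative - complex_of_real (excess (u t)) * u t - 2 * \<i> * of_real A * s t + \<i> * of_real A * x t) (at t within S)"
    and A: "A > 0"
  shows "((\<lambda>t. Im (cnj (u t) * s t)) has_real_derivative A * defect (u t) (s t) (x t) - excess (u t) * Im (cnj (u t) * s t) + A * (cmod (s t))\<^sup>2) (at t within S)" (is ?Q)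
   and "((\<lambda>t. skew A (u t) (s t)) has_real_derivative A * defect (u t) (s t) (x t) - 2 * skew A (u t) (s t) + skew_err A (u t) (s t)) (at t within S)" (is ?Y)
proof -
  show Q: ?Q
    by (rule DERIV_cong[OF cnj_mult_deriv(2)[OF u s]], unfold cmod_power2)
       (simp add: defect_def power2_eq_square algebra_simps)
  show ?Y unfolding skew_def[abs_def]
    by (rule DERIV_cong[OF DERIV_diff[OF Q DERIV_cdivide[OF excess_deriv[where u=u and s=s and t=t, OF u A]]]])
       (use A in \<open>simp add: skew_def skew_err_def field_simps power2_eq_square\<close>)
qed

lemma defect_deriv:
  assumes u: "(u has_vector_derivative - complex_of_real (excess (u t)) * u t - \<i> * of_real A * s t) (at t within S)"
    and s: "(s has_vector_derivative - complex_of_real (excess (u t)) * u t - 2 * \<i> * of_real A * s t + \<i> * of_real A * x t) (at t within S)"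
    and x: "(x has_vector_derivative - B - \<i> * of_real A * x t) (at t within S)"
    and A: "A > 0"
  shows "((\<lambda>t. Re (cnj (u t) * x t)) has_real_derivative - excess (u t) * Re (cnj (u t) * x t) - A * Im (cnj (s t) * x t)
    - Re (cnj (u t) * B) + A * Im (cnj (u t) * x t)) (at t within S)" (is ?G)
   and "((\<lambda>t. defect (u t) (s t) (x t)) has_real_derivative defect_rate A (u t) (s t) (x t) B + defect_err A (u t) (s t) (x t)) (at t within S)" (is ?M)
proof -
  show G: ?G
    by (rule DERIV_cong[OF cnj_mult_deriv(1)[OF u x]]) (simp add: algebra_simps)
  define r where "r = excess (u t)"
  define a where "a = Re (u t)"
  define b where "b = Im (u t)"
  have r: "r = a * a + b * b - 1" by (simp add: r_def a_def b_def excess_alt)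
  have P: "((\<lambda>t. Re (cnj (u t) * s t)) has_real_derivative 
     - excess (u t) * Re (cnj (u t) * s t) - excess (u t) - (excess (u t))\<^sup>2 + 2 * A * Im (cnj (u t) * s t) - A * Im (cnj (u t) * x t)) (at t within S)"
    apply (rule DERIV_cong[OF cnj_mult_deriv(1)[OF u s]])
    apply (simp flip: r_def a_def b_def)
    apply (simp add: r algebra_simps power2_eq_square)
    done
  show ?M unfolding defect_def[abs_def]
    by (rule DERIV_cong[OF DERIV_diff[OF G DERIV_cmult[OF P]]])
       (use A in \<open>simp add: skew_def defect_rate_def defect_err_def field_simps power2_eq_square\<close>)
qed

text \<open>The derivative of \<open>lyap\<close> along the flow. The quadratic terms
  \<open>- A * Im (cnj s * x)\<close> and \<open>(Re (cnj x * B) - \<rho> * g) / 2\<close> have no sign, but each of them sums to zero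
  over the agents.\<close>
definition lyap_rate :: "real \<Rightarrow> real \<Rightarrow> complex \<Rightarrow> complex \<Rightarrow> complex \<Rightarrow> complex \<Rightarrow> real"
  where "lyap_rate A \<mu> u s x B = (let \<rho> = excess u; q = Im (cnj u * s); g = Re (cnj u * x);
      y = skew A u s; m = defect u s x; \<rho>' = 2 * A * y - 2 * \<rho>\<^sup>2;
      m' = defect_rate A u s x B + defect_err A u s x in
    - y\<^sup>2 + \<rho>\<^sup>2 * y / A + (\<rho>\<^sup>2 * q - A * \<rho> * (cmod s)\<^sup>2) / (2 * A)
    - A * Im (cnj s * x) + (Re (cnj x * B) - \<rho> * g) / 2
    - \<mu> ^ 6 * ((A * m - 2 * y + skew_err A u s) * m + y * m')
    - \<mu> ^ 8 * (\<rho>' * g + \<rho> * (- \<rho> * g - A * Im (cnj s * x) - Re (cnj u * B) + A * Im (cnj u * x)))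
    + \<mu> ^ 10 * (m' * \<rho> + m * \<rho>'))"

lemma lyap_deriv:
  assumes u: "(u has_vector_derivative - complex_of_real (excess (u t)) * u t - \<i> * of_real A * s t) (at t within S)"
    and s: "(s has_vector_derivative - complex_of_real (excess (u t)) * u t - 2 * \<i> * of_real A * s t + \<i> * of_real A * x t) (at t within S)"
    and x: "(x has_vector_derivative - B - \<i> * of_real A * x t) (at t within S)"
    and A: "A > 0"
  shows "((\<lambda>t. lyap A \<mu> (u t) (s t) (x t)) has_real_derivative lyap_rate A \<mu> (u t) (s t) (x t) B) (at t within S)"
proof -
  have sq: "((\<lambda>t. (cmod (f t))\<^sup>2) has_real_derivative 2 * Re (cnj (f t) * D)) (at t within S)"
    if "(f has_vector_derivative D) (at t within S)" for f :: "real \<Rightarrow> complex" and D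
    using DERIV_cong[OF cnj_mult_deriv(1)[OF that that], of "2 * Re (cnj (f t) * D)"]
    unfolding cmod_power2 by (simp add: power2_eq_square algebra_simps)
  have s2: "((\<lambda>t. (cmod (s t))\<^sup>2) has_real_derivative - 2 * excess (u t) * Re (cnj (u t) * s t) - 2 * A * Im (cnj (s t) * x t)) (at t within S)"
    by (rule DERIV_cong[OF sq[OF s]]) (simp add: algebra_simps)
  have x2: "((\<lambda>t. (cmod (x t))\<^sup>2) has_real_derivative - 2 * Re (cnj (x t) * B)) (at t within S)"
    by (rule DERIV_cong[OF sq[OF x]]) (simp add: algebra_simps)
  note d = excess_deriv[where u=u and s=s and t=t, OF u A] skew_deriv[where u=u and s=s and x=x and t=t, OF u s A] defect_deriv[where u=u and s=s and x=x and t=t, OF u s x A]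
  have qy: "Im (cnj (u t) * s t) = skew A (u t) (s t) + excess (u t) / A" by (simp add: skew_def)
  have p: "Re (cnj (u t) * s t) = (Re (cnj (u t) * x t) - defect (u t) (s t) (x t)) / 2" by (simp add: defect_def)
  show ?thesis
    unfolding lyap_def[abs_def]
    apply (rule DERIV_cong)
     apply (rule d s2 x2 DERIV_add DERIV_diff DERIV_cdivide DERIV_cmult DERIV_mult DERIV_power)+
    unfolding lyap_rate_def Let_def p qy
    using A apply (simp add: field_simps power2_eq_square del: times_complex.sel)
    done
qed

section \<open>Bounding the rate of one agent\<close>
lemma abs_mult_le: "\<bar>a\<bar> \<le> c \<Longrightarrow> \<bar>b\<bar> \<le> d \<Longrightarrow> \<bar>a * b\<bar> \<le> c * (d::real)"
  unfolding abs_mult by (intro mult_mono) auto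

text \<open>With \<open>\<mu> ^ i * a\<close> and \<open>\<mu> ^ j * b\<close> as new unknowns, a product \<open>a * b\<close> whose coefficient is at
  most \<open>\<mu> ^ (i + j + 1)\<close> is negligible.\<close>
lemma weighted_cross_term:
  fixes \<mu> a b :: real
  assumes "0 < \<mu>" "\<mu> \<le> 1" "i + j < k"
  shows "\<mu> ^ k * \<bar>a * b\<bar> \<le> \<mu> * ((\<mu> ^ i * a)\<^sup>2 + (\<mu> ^ j * b)\<^sup>2) / 2"
proof -
  have "\<mu> ^ k \<le> \<mu> ^ (Suc (i + j))"
    using assms by (intro power_decreasing) auto
  then have "\<mu> ^ k * \<bar>a * b\<bar> \<le> \<mu> ^ Suc (i + j) * \<bar>a * b\<bar>" by (rule mult_right_mono) auto
  also have "\<dots> = \<mu> * (\<bar>\<mu> ^ i * a\<bar> * \<bar>\<mu> ^ j * b\<bar>)"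
    using assms by (simp add: abs_mult power_add)
  also have "\<dots> \<le> \<mu> * (((\<mu> ^ i * a)\<^sup>2 + (\<mu> ^ j * b)\<^sup>2) / 2)"
    using sum_squares_bound[of "\<bar>\<mu> ^ i * a\<bar>" "\<bar>\<mu> ^ j * b\<bar>"] assms(1) by (intro mult_left_mono) auto
  finally show ?thesis by simp
qed

text \<open>Crude bounds in terms of a single size \<open>a\<close>; the constant \<open>\<alpha>\<close> dominates 1, \<open>A\<close> and \<open>1/A\<close>.\<close>
lemma agent_bounds:
  assumes A: "A > 0" and \<rho>: "\<bar>excess u\<bar> \<le> 1"
    and \<alpha>: "\<alpha> \<ge> 1" "\<alpha> \<ge> A" "\<alpha> \<ge> 1 / A"
    and a: "\<bar>excess u\<bar> \<le> a" "cmod s \<le> a" "cmod x \<le> a"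
  shows "cmod u \<le> 2" "\<bar>Re (cnj u * w)\<bar> \<le> 2 * cmod w" "\<bar>Im (cnj u * w)\<bar> \<le> 2 * cmod w"
    "\<bar>Im (cnj s * x)\<bar> \<le> a * a"
    "\<bar>skew A u s\<bar> \<le> 3 * \<alpha> * a" "\<bar>defect u s x\<bar> \<le> 6 * a"
    "\<bar>skew_err A u s\<bar> \<le> 5 * \<alpha> * a\<^sup>2" "\<bar>defect_err A u s x\<bar> \<le> 9 * \<alpha> * a\<^sup>2"
proof -
  have "(cmod u)\<^sup>2 \<le> 2\<^sup>2" using \<rho> unfolding excess_def by simp
  then show u: "cmod u \<le> 2" by (rule power2_le_imp_le) simp
  have uw: "cmod (cnj u * w) \<le> 2 * cmod w" for w
    using u by (simp add: norm_mult mult_right_mono)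
  show re: "\<bar>Re (cnj u * w)\<bar> \<le> 2 * cmod w" and im: "\<bar>Im (cnj u * w)\<bar> \<le> 2 * cmod w" for w
    using abs_Re_le_cmod[of "cnj u * w"] abs_Im_le_cmod[of "cnj u * w"] uw[of w] by linarith+
  have a0: "a \<ge> 0" using a(2) norm_ge_zero[of s] by linarith
  have "cmod (cnj s * x) \<le> a * a" using a a0 by (simp add: norm_mult mult_mono)
  then show sx: "\<bar>Im (cnj s * x)\<bar> \<le> a * a" using abs_Im_le_cmod[of "cnj s * x"] by linarith
  have p: "\<bar>Re (cnj u * s)\<bar> \<le> 2 * a" and q: "\<bar>Im (cnj u * s)\<bar> \<le> 2 * a" and g: "\<bar>Re (cnj u * x)\<bar> \<le> 2 * a"
    using re[of s] im[of s] re[of x] a by linarith+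
  have a\<alpha>: "a \<le> \<alpha> * a" "a * a \<le> \<alpha> * (a * a)" "A * (a * a) \<le> \<alpha> * (a * a)"
    using mult_right_mono[OF \<alpha>(1), of a] mult_right_mono[OF \<alpha>(1), of "a * a"]
      mult_right_mono[OF \<alpha>(2), of "a * a"] a0 by simp_all
  have "\<bar>excess u * (1 / A)\<bar> \<le> a * \<alpha>"
    using a \<alpha> A by (intro abs_mult_le) auto
  then have e1: "\<bar>excess u / A\<bar> \<le> \<alpha> * a" by (simp add: mult.commute)
  show y: "\<bar>skew A u s\<bar> \<le> 3 * \<alpha> * a"
    unfolding skew_def using e1 q a\<alpha> by linarith
  show m: "\<bar>defect u s x\<bar> \<le> 6 * a"
    unfolding defect_def using p g by linarith
  have r2: "\<bar>excess u * excess u\<bar> \<le> a * a" using a by (intro abs_mult_le)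
  have r2A: "\<bar>excess u * excess u * (1/A)\<bar> \<le> a * a * \<alpha>" 
    using A \<alpha> by (intro abs_mult_le[OF r2]) auto
  have s2: "cmod s * cmod s \<le> a * a" using a a0 by (intro mult_mono) auto
  have As2: "\<bar>A * (cmod s * cmod s)\<bar> \<le> \<alpha> * (a * a)" 
    using \<alpha> A s2 by (intro abs_mult_le[of A \<alpha> "cmod s * cmod s"]) auto
  have t1: "\<bar>excess u * Im (cnj u * s)\<bar> \<le> a * (2 * a)" "\<bar>excess u * Re (cnj u * s)\<bar> \<le> a * (2 * a)" 
     "\<bar>excess u * Re (cnj u * x)\<bar> \<le> a * (2 * a)" "\<bar>A * Im (cnj s * x)\<bar> \<le> \<alpha> * (a * a)"
    using a p q g sx \<alpha> A by (auto intro!: abs_mult_le simp del: times_complex.sel)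
  have g1: "a * (2 * a) = 2 * (a * a)" "a * a * \<alpha> = \<alpha> * (a * a)" "5 * \<alpha> * a\<^sup>2 = 5 * (\<alpha> * (a * a))"
    "9 * \<alpha> * a\<^sup>2 = 9 * (\<alpha> * (a * a))" by (simp_all add: power2_eq_square)
  have "skew_err A u s = - (excess u * Im (cnj u * s)) + A * (cmod s * cmod s) + 2 * (excess u * excess u * (1/A))"
    unfolding skew_err_def by (simp add: power2_eq_square del: times_complex.sel)
  then show "\<bar>skew_err A u s\<bar> \<le> 5 * \<alpha> * a\<^sup>2"
    using t1(1) As2 r2A a\<alpha>(2) unfolding g1 by linarith
  have "defect_err A u s x = - (excess u * Re (cnj u * x)) - A * Im (cnj s * x) + 2 * (excess u * Re (cnj u * s)) + 2 * (excess u * excess u)"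
    unfolding defect_err_def by (simp add: power2_eq_square del: times_complex.sel)
  then show "\<bar>defect_err A u s x\<bar> \<le> 9 * \<alpha> * a\<^sup>2"
    using t1 r2 a\<alpha>(2) unfolding g1 by linarith
qed

text \<open>The square norm in which the dissipation is measured: the squares of \<open>y\<close>, \<open>m\<close>, \<open>|x|\<close> and \<open>\<rho>\<close>
  carry the powers of \<open>\<mu>\<close> with which their dissipation terms occur.\<close>
definition weighted_norm :: "real \<Rightarrow> real \<Rightarrow> complex \<Rightarrow> complex \<Rightarrow> complex \<Rightarrow> real"
  where "weighted_norm A \<mu> u s x = (skew A u s)\<^sup>2 + (\<mu> ^ 3 * defect u s x)\<^sup>2 + (\<mu> ^ 4 * cmod x)\<^sup>2 + (\<mu> ^ 5 * excess u)\<^sup>2"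

text \<open>The rate splits into negative squares of \<open>y\<close>, \<open>m\<close> and \<open>\<rho>\<close>, cross terms of relative size \<open>\<mu>\<close>, a
  cubic error, and four terms which can only be evaluated after summation over the agents. The
  dissipation in \<open>x\<close> is hidden in the one with factor \<open>\<mu> ^ 8\<close>.\<close>
lemma lyap_rate_bound:
  assumes A: "A > 0" and \<mu>: "0 < \<mu>" "\<mu> \<le> 1" and \<rho>: "\<bar>excess u\<bar> \<le> 1"
    and \<alpha>: "\<alpha> \<ge> 1" "\<alpha> \<ge> A" "\<alpha> \<ge> 1 / A"
    and a: "\<bar>excess u\<bar> \<le> a" "cmod s \<le> a" "cmod x \<le> a"
  shows "lyap_rate A \<mu> u s x B 
    \<le> - (skew A u s)\<^sup>2 - A * (\<mu> ^ 3 * defect u s x)\<^sup>2 - 2 * (\<mu> ^ 5 * excess u)\<^sup>2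
      + 18 * \<alpha> * \<mu> * (weighted_norm A \<mu> u s x + (\<mu> ^ 5 * cmod B)\<^sup>2) + 100 * \<alpha>\<^sup>2 * a ^ 3
      - A * Im (cnj s * x) + (Re (cnj x * B) - excess u * Re (cnj u * x)) / 2
      - \<mu> ^ 8 * (excess u * (A * Im (cnj u * x) - Re (cnj u * B)))
      - \<mu> ^ 10 * (excess u * Re (cnj u * B))"
proof -
  define r y m q g f b D where "r = excess u" "y = skew A u s" "m = defect u s x"
    "q = Im (cnj u * s)" "g = Re (cnj u * x)" "f = Im (cnj u * x)" "b = Re (cnj u * B)" "D = Im (cnj s * x)"
  note d = this
  define ry rm where "ry = skew_err A u s" "rm = defect_err A u s x"
  note d2 = this
  \<comment> \<open>The cubic parts of the rate, by their coefficients 1, \<open>\<mu>^6\<close>, \<open>\<mu>^8\<close>, \<open>\<mu>^10\<close>.\<close>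
  define c1 where "c1 = r\<^sup>2 * y / A + (r\<^sup>2 * q - A * r * (cmod s)\<^sup>2) / (2 * A)"
  define c2 where "c2 = ry * m + y * rm"
  define c3 where "c3 = - 3 * r\<^sup>2 * g - r * A * D"
  define c4 where "c4 = rm * r - 2 * m * r\<^sup>2"
  define Q where "Q = weighted_norm A \<mu> u s x + (\<mu> ^ 5 * cmod B)\<^sup>2"
  have split: "lyap_rate A \<mu> u s x B = - y\<^sup>2 - \<mu> ^ 6 * A * m\<^sup>2 - 2 * \<mu> ^ 10 * r\<^sup>2
      + c1 - \<mu> ^ 6 * c2 - \<mu> ^ 8 * c3 + \<mu> ^ 10 * c4
      + \<mu> ^ 6 * (2 * (y * m) + 2 * (y * r) + 4 * A * (y * y) - 3 * A * (y * f) + y * b)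
      - \<mu> ^ 8 * (2 * A * (y * g))
      + \<mu> ^ 10 * (2 * A * (m * y) - 4 * A * (r * y) + 3 * A * (r * f))
      - A * D + (Re (cnj x * B) - r * g) / 2 - \<mu> ^ 8 * (r * (A * f - b)) - \<mu> ^ 10 * (r * b)"
    unfolding lyap_rate_def Let_def c1_def c2_def c3_def c4_def defect_rate_def d[symmetric] d2[symmetric]
    by (simp add: algebra_simps power2_eq_square del: times_complex.sel)
  note bd = agent_bounds[OF A \<rho> \<alpha> a]
  have a0: "a \<ge> 0" using a(2) norm_ge_zero[of s] by linarith
  have cub: "c1 - \<mu> ^ 6 * c2 - \<mu> ^ 8 * c3 + \<mu> ^ 10 * c4 \<le> 100 * \<alpha>\<^sup>2 * a ^ 3"
  proof -
    define Z where "Z = \<alpha>\<^sup>2 * a ^ 3"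
    have \<alpha>2: "\<alpha> \<le> \<alpha>\<^sup>2" "1 \<le> \<alpha>\<^sup>2" 
      using \<alpha>(1) power_increasing[of 1 2 \<alpha>] one_le_power[of \<alpha> 2] by simp_all
    have a3: "a ^ 3 \<le> Z" "\<alpha> * a ^ 3 \<le> Z" "Z \<ge> 0"
      unfolding Z_def using mult_right_mono[OF \<alpha>2(1), of "a ^ 3"] mult_right_mono[OF \<alpha>2(2), of "a ^ 3"] a0 by simp_all
    have b1: "\<bar>r\<bar> \<le> a" "\<bar>D\<bar> \<le> a * a" "\<bar>y\<bar> \<le> 3 * \<alpha> * a" "\<bar>m\<bar> \<le> 6 * a" 
       "\<bar>ry\<bar> \<le> 5 * \<alpha> * a\<^sup>2" "\<bar>rm\<bar> \<le> 9 * \<alpha> * a\<^sup>2"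
      unfolding d d2 by (rule bd a)+
    have b2: "\<bar>q\<bar> \<le> 2 * a" unfolding d by (rule order_trans[OF bd(3)]) (use a in simp)
    have b3: "\<bar>g\<bar> \<le> 2 * a" unfolding d by (rule order_trans[OF bd(2)]) (use a in simp)
    have b4: "\<bar>1 / A\<bar> \<le> \<alpha>" "\<bar>A\<bar> \<le> \<alpha>" "\<bar>cmod s\<bar> \<le> a"
      using \<alpha> A a by simp_all
    note b = b1 b2 b3 b4
    define t1 t2 t3 where "t1 = r * r * (1 / A) * y" "t2 = r * r * (1 / A) * q" "t3 = r * cmod s * cmod s"
    note t = this
    have "\<bar>t1\<bar> \<le> a * a * \<alpha> * (3 * \<alpha> * a)" "\<bar>t2\<bar> \<le> a * a * \<alpha> * (2 * a)" "\<bar>t3\<bar> \<le> a * a * a"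
      unfolding t by (intro abs_mult_le b)+
    moreover have "c1 = t1 + t2 / 2 - t3 / 2"
      using A by (simp add: c1_def t field_simps power2_eq_square)
    moreover have "a * a * \<alpha> * (3 * \<alpha> * a) = 3 * Z" "a * a * \<alpha> * (2 * a) = 2 * (\<alpha> * a ^ 3)" "a * a * a = a ^ 3"
      by (simp_all add: Z_def power2_eq_square power3_eq_cube)
    ultimately have c1: "\<bar>c1\<bar> \<le> 5 * Z" using a3 by linarith
    have "\<bar>ry * m\<bar> \<le> 5 * \<alpha> * a\<^sup>2 * (6 * a)" "\<bar>y * rm\<bar> \<le> 3 * \<alpha> * a * (9 * \<alpha> * a\<^sup>2)"
      by (intro abs_mult_le b)+
    moreover have "5 * \<alpha> * a\<^sup>2 * (6 * a) = 30 * (\<alpha> * a ^ 3)" "3 * \<alpha> * a * (9 * \<alpha> * a\<^sup>2) = 27 * Z"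
      by (simp_all add: Z_def power2_eq_square power3_eq_cube)
    ultimately have c2: "\<bar>c2\<bar> \<le> 57 * Z" using a3 unfolding c2_def by linarith
    have "\<bar>r * r * g\<bar> \<le> a * a * (2 * a)" "\<bar>r * A * D\<bar> \<le> a * \<alpha> * (a * a)"
      by (intro abs_mult_le b)+
    moreover have "a * a * (2 * a) = 2 * a ^ 3" "a * \<alpha> * (a * a) = \<alpha> * a ^ 3" "c3 = - 3 * (r * r * g) - r * A * D"
      by (simp_all add: c3_def power2_eq_square power3_eq_cube)
    ultimately have c3: "\<bar>c3\<bar> \<le> 7 * Z" using a3 by linarith
    have "\<bar>rm * r\<bar> \<le> 9 * \<alpha> * a\<^sup>2 * a" "\<bar>m * r * r\<bar> \<le> 6 * a * a * a"
      by (intro abs_mult_le b)+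
    moreover have "9 * \<alpha> * a\<^sup>2 * a = 9 * (\<alpha> * a ^ 3)" "6 * a * a * a = 6 * a ^ 3" "c4 = rm * r - 2 * (m * r * r)"
      by (simp_all add: c4_def power2_eq_square power3_eq_cube)
    ultimately have c4: "\<bar>c4\<bar> \<le> 21 * Z" using a3 by linarith
    have sm: "\<bar>\<mu> ^ k * c\<bar> \<le> \<bar>c\<bar>" for k c
      using \<mu> power_le_one[of \<mu> k] mult_right_mono[of "\<mu> ^ k" 1 "\<bar>c\<bar>"] by (simp add: abs_mult)
    show ?thesis
      using c1 c2 c3 c4 sm[of 6 c2] sm[of 8 c3] sm[of 10 c4] a3(3) unfolding Z_def by linarith
  qed
  have xf: "\<mu> ^ k * \<bar>z * f\<bar> \<le> 2 * (\<mu> ^ k * \<bar>z * cmod x\<bar>)" 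
     "\<mu> ^ k * \<bar>z * g\<bar> \<le> 2 * (\<mu> ^ k * \<bar>z * cmod x\<bar>)"
     "\<mu> ^ k * \<bar>z * b\<bar> \<le> 2 * (\<mu> ^ k * \<bar>z * cmod B\<bar>)" for z k
  proof -
    have "\<bar>z * f\<bar> \<le> \<bar>z\<bar> * (2 * cmod x)" "\<bar>z * g\<bar> \<le> \<bar>z\<bar> * (2 * cmod x)" "\<bar>z * b\<bar> \<le> \<bar>z\<bar> * (2 * cmod B)"
      unfolding d using bd(2,3) by (auto intro!: abs_mult_le simp del: times_complex.sel)
    from this[THEN mult_left_mono, of "\<mu> ^ k"] show
      "\<mu> ^ k * \<bar>z * f\<bar> \<le> 2 * (\<mu> ^ k * \<bar>z * cmod x\<bar>)" 
     "\<mu> ^ k * \<bar>z * g\<bar> \<le> 2 * (\<mu> ^ k * \<bar>z * cmod x\<bar>)"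
     "\<mu> ^ k * \<bar>z * b\<bar> \<le> 2 * (\<mu> ^ k * \<bar>z * cmod B\<bar>)"
      using \<mu> by (simp_all add: abs_mult)
  qed
  have Q: "Q = y\<^sup>2 + (\<mu> ^ 3 * m)\<^sup>2 + (\<mu> ^ 4 * cmod x)\<^sup>2 + (\<mu> ^ 5 * r)\<^sup>2 + (\<mu> ^ 5 * cmod B)\<^sup>2"
    by (simp add: Q_def weighted_norm_def d)
  have half: "\<mu> * (Z + W) / 2 \<le> \<mu> * Q / 2" if "Z + W \<le> Q" for Z W
    using \<mu> that by (simp add: mult_left_mono)
  have Q0: "\<mu> * Q \<ge> 0" using \<mu> by (simp add: Q)
  note wc = weighted_cross_term[OF \<mu>]
  have k1: "\<mu> ^ 6 * \<bar>y * m\<bar> \<le> \<mu> * Q / 2"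
    by (rule order_trans[OF wc[of 0 3] half]) (auto simp: Q)
  have k2: "\<mu> ^ 6 * \<bar>y * r\<bar> \<le> \<mu> * Q / 2"
    by (rule order_trans[OF wc[of 0 5] half]) (auto simp: Q)
  have k3: "\<mu> ^ 6 * \<bar>y * y\<bar> \<le> \<mu> * Q"
  proof -
    have "\<mu> ^ 6 * \<bar>y * y\<bar> \<le> \<mu> * y\<^sup>2" using wc[of 0 0 6 y y] by simp
    also have "\<dots> \<le> \<mu> * Q" using \<mu> by (intro mult_left_mono) (auto simp: Q)
    finally show ?thesis .
  qed
  have k4: "\<mu> ^ 6 * \<bar>y * f\<bar> \<le> \<mu> * Q"
    using xf(1)[of 6 y] order_trans[OF wc[of 0 4 6 y "cmod x"] half] by (auto simp: Q)
  have k5: "\<mu> ^ 6 * \<bar>y * b\<bar> \<le> \<mu> * Q"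
    using xf(3)[of 6 y] order_trans[OF wc[of 0 5 6 y "cmod B"] half] by (auto simp: Q)
  have k6: "\<mu> ^ 8 * \<bar>y * g\<bar> \<le> \<mu> * Q"
    using xf(2)[of 8 y] order_trans[OF wc[of 0 4 8 y "cmod x"] half] by (auto simp: Q)
  have k7: "\<mu> ^ 10 * \<bar>m * y\<bar> \<le> \<mu> * Q / 2"
    by (rule order_trans[OF wc[of 3 0] half]) (auto simp: Q)
  have k8: "\<mu> ^ 10 * \<bar>r * y\<bar> \<le> \<mu> * Q / 2"
    by (rule order_trans[OF wc[of 5 0] half]) (auto simp: Q)
  have k9: "\<mu> ^ 10 * \<bar>r * f\<bar> \<le> \<mu> * Q"
    using xf(1)[of 10 r] order_trans[OF wc[of 5 4 10 r "cmod x"] half] by (auto simp: Q)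
  have ab: "\<mu> ^ k * z \<le> \<mu> ^ k * \<bar>z\<bar>" "- (\<mu> ^ k * z) \<le> \<mu> ^ k * \<bar>z\<bar>" for k z
    using \<mu> mult_left_mono[of z "\<bar>z\<bar>" "\<mu> ^ k"] mult_left_mono[of "-z" "\<bar>z\<bar>" "\<mu> ^ k"] by auto
  have A1: "c * (A * T) \<le> c * (\<alpha> * (\<mu> * Q))" if "T \<le> \<mu> * Q" "c \<ge> 0" for T c
  proof -
    have "A * T \<le> A * (\<mu> * Q)" using that A by simp
    also have "\<dots> \<le> \<alpha> * (\<mu> * Q)" using \<alpha> Q0 by (intro mult_right_mono) auto
    finally show ?thesis using that by (simp add: mult_left_mono)
  qed
  have T: "T \<le> \<alpha> * (\<mu> * Q)" if "T \<le> \<mu> * Q" for T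
    using that mult_right_mono[OF \<alpha>(1) Q0] by linarith
  have cr: "\<mu> ^ 6 * (2 * (y * m) + 2 * (y * r) + 4 * A * (y * y) - 3 * A * (y * f) + y * b)
      - \<mu> ^ 8 * (2 * A * (y * g))
      + \<mu> ^ 10 * (2 * A * (m * y) - 4 * A * (r * y) + 3 * A * (r * f)) \<le> 18 * (\<alpha> * (\<mu> * Q))"
  proof -
    have "2 * (\<mu> ^ 6 * (y * m)) \<le> \<mu> * Q" using k1 ab(1)[of 6 "y * m"] by linarith
    note 1 = T[OF this]
    have "2 * (\<mu> ^ 6 * (y * r)) \<le> \<mu> * Q" using k2 ab(1)[of 6 "y * r"] by linarith
    note 2 = T[OF this]
    have "\<mu> ^ 6 * (y * y) \<le> \<mu> * Q" using k3 ab(1)[of 6 "y * y"] by linarith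
    note 3 = A1[OF this, of 4]
    have "- (\<mu> ^ 6 * (y * f)) \<le> \<mu> * Q" using k4 ab(2)[of 6 "y * f"] by linarith
    note 4 = A1[OF this, of 3]
    have "\<mu> ^ 6 * (y * b) \<le> \<mu> * Q" using k5 ab(1)[of 6 "y * b"] by linarith
    note 5 = T[OF this]
    have "- (\<mu> ^ 8 * (y * g)) \<le> \<mu> * Q" using k6 ab(2)[of 8 "y * g"] by linarith
    note 6 = A1[OF this, of 2]
    have "2 * (\<mu> ^ 10 * (m * y)) \<le> \<mu> * Q" using k7 ab(1)[of 10 "m * y"] by linarith
    note 7 = A1[OF this, of 1]
    have "2 * - (\<mu> ^ 10 * (r * y)) \<le> \<mu> * Q" using k8 ab(2)[of 10 "r * y"] by linarith
    note 8 = A1[OF this, of 2]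
    have "\<mu> ^ 10 * (r * f) \<le> \<mu> * Q" using k9 ab(1)[of 10 "r * f"] by linarith
    note 9 = A1[OF this, of 3]
    have "\<mu> ^ 6 * (2 * (y * m) + 2 * (y * r) + 4 * A * (y * y) - 3 * A * (y * f) + y * b)
      - \<mu> ^ 8 * (2 * A * (y * g))
      + \<mu> ^ 10 * (2 * A * (m * y) - 4 * A * (r * y) + 3 * A * (r * f))
     = 2 * (\<mu> ^ 6 * (y * m)) + 2 * (\<mu> ^ 6 * (y * r)) + 4 * (A * (\<mu> ^ 6 * (y * y)))
      + 3 * (A * - (\<mu> ^ 6 * (y * f))) + \<mu> ^ 6 * (y * b) + 2 * (A * - (\<mu> ^ 8 * (y * g)))
      + 1 * (A * (2 * (\<mu> ^ 10 * (m * y)))) + 2 * (A * (2 * - (\<mu> ^ 10 * (r * y)))) + 3 * (A * (\<mu> ^ 10 * (r * f)))"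
      by (simp add: ring_distribs mult.assoc mult.left_commute)
    also have "\<dots> \<le> \<alpha> * (\<mu> * Q) + \<alpha> * (\<mu> * Q) + 4 * (\<alpha> * (\<mu> * Q)) + 3 * (\<alpha> * (\<mu> * Q)) + \<alpha> * (\<mu> * Q)
      + 2 * (\<alpha> * (\<mu> * Q)) + 1 * (\<alpha> * (\<mu> * Q)) + 2 * (\<alpha> * (\<mu> * Q)) + 3 * (\<alpha> * (\<mu> * Q))"
      by (intro add_mono 1 2 3 4 5 6 7 8 9) simp_all
    finally show ?thesis by linarith
  qed
  have "A * (\<mu> ^ 3 * m)\<^sup>2 = \<mu> ^ 6 * A * m\<^sup>2" "2 * (\<mu> ^ 5 * r)\<^sup>2 = 2 * \<mu> ^ 10 * r\<^sup>2" "18 * \<alpha> * \<mu> * Q = 18 * (\<alpha> * (\<mu> * Q))"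
    by (simp_all add: power_mult_distrib flip: power_mult)
  then show ?thesis
    unfolding split Q_def[symmetric] d[symmetric] using cub cr by linarith
qed

section \<open>Mean-field identities and noncollinearity\<close>
lemma sum_of_signs_odd:
  fixes f :: "'a \<Rightarrow> int"
  assumes "finite I" "\<And>k. k \<in> I \<Longrightarrow> \<bar>f k\<bar> = 1"
  shows "odd (sum f I) \<longleftrightarrow> odd (card I)"
  using assms
proof (induction I rule: finite_induct)
  case (insert k I)
  then have "odd (f k)" by (metis dvd_abs_iff insertI1 odd_one)
  with insert show ?case by simp
qed simp

text \<open>If \<open>x\<close> were almost orthogonal to all \<open>u k\<close>, the components of the \<open>u k\<close> along \<open>\<i> x\<close> would be close to
  \<open>\<plusminus>1\<close>. A sum of an odd number of signs is at least 1 in absolute value, which contradicts the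
  smallness of the sum of the \<open>u k\<close>.\<close>
lemma odd_balanced_noncollinear:
  fixes u :: "nat \<Rightarrow> complex"
  assumes "odd n" and \<rho>: "\<And>k. k \<in> {1..n} \<Longrightarrow> \<bar>excess (u k)\<bar> \<le> 1 / (4 * real n)"
    and mean: "cmod (\<Sum>k=1..n. u k) \<le> 1 / 4"
  shows "(cmod x)\<^sup>2 / (4 * real n) \<le> (\<Sum>k=1..n. (Re (cnj (u k) * x))\<^sup>2)"
proof (rule ccontr)
  assume "\<not> ?thesis"
  then have less: "(\<Sum>k=1..n. (Re (cnj (u k) * x))\<^sup>2) < (cmod x)\<^sup>2 / (4 * real n)" by simp
  have n: "n \<ge> 1" using \<open>odd n\<close> by (cases n) auto
  have "0 \<le> (\<Sum>k=1..n. (Re (cnj (u k) * x))\<^sup>2)" by (intro sum_nonneg) auto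
  with less have "(cmod x)\<^sup>2 / (4 * real n) > 0" by linarith
  then have x0: "cmod x > 0" by (auto simp: zero_less_divide_iff)
  define b where "b = x / of_real (cmod x)"
  have b: "cmod b = 1" and xb: "x = of_real (cmod x) * b" using x0 by (simp_all add: b_def norm_divide)
  define R J where "R k = Re (cnj (u k) * b)" "J k = Im (cnj (u k) * b)" for k
  have "Re (cnj (u k) * x) = cmod x * R k" for k
    by (subst xb) (simp add: R_J_def algebra_simps)
  then have "(cmod x)\<^sup>2 * (\<Sum>k=1..n. (R k)\<^sup>2) < (cmod x)\<^sup>2 * (1 / (4 * real n))"
    using less by (simp add: power_mult_distrib sum_distrib_left)
  then have sumR: "(\<Sum>k=1..n. (R k)\<^sup>2) < 1 / (4 * real n)" using x0 by (simp only: mult_less_cancel_left) auto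
  have "sgn (J k) \<in> {-1,1} \<and> \<bar>J k - sgn (J k)\<bar> \<le> 1 / (2 * real n)" if k: "k \<in> {1..n}" for k
  proof -
    have "(R k)\<^sup>2 \<le> (\<Sum>k=1..n. (R k)\<^sup>2)" using k by (intro member_le_sum) auto
    with sumR have Rk: "(R k)\<^sup>2 < 1 / (4 * real n)" by linarith
    have "(R k)\<^sup>2 + (J k)\<^sup>2 = (cmod (cnj (u k) * b))\<^sup>2" by (simp add: R_J_def cmod_power2 del: times_complex.sel)
    then have RJ: "(R k)\<^sup>2 + (J k)\<^sup>2 = 1 + excess (u k)" by (simp add: norm_mult b excess_def)
    have q: "1 / (4 * real n) \<le> 1 / 4" "1 / (4 * real n) + 1 / (4 * real n) = 1 / (2 * real n)" using n by (simp_all add: field_simps)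
    have e: "\<bar>(J k)\<^sup>2 - 1\<bar> \<le> 1 / (2 * real n)" 
      using RJ Rk \<rho>[OF k] q zero_le_power2[of "R k"] by linarith
    have "1 / (2 * real n) \<le> 1 / 2" using n by (simp add: field_simps)
    with e have "(J k)\<^sup>2 \<noteq> 0" by linarith
    then have J0: "J k \<noteq> 0" by simp
    then have "sgn (J k) \<in> {-1,1}" by (auto simp: sgn_if)
    moreover have "\<bar>J k - sgn (J k)\<bar> = \<bar>\<bar>J k\<bar> - 1\<bar>" by (use J0 in \<open>auto simp: sgn_if\<close>)
    moreover have "\<bar>\<bar>J k\<bar> - 1\<bar> \<le> \<bar>(J k)\<^sup>2 - 1\<bar>"
    proof -
      have "(J k)\<^sup>2 - 1 = (\<bar>J k\<bar> - 1) * (\<bar>J k\<bar> + 1)"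
        by (simp add: algebra_simps power2_eq_square)
      then have "\<bar>(J k)\<^sup>2 - 1\<bar> = \<bar>\<bar>J k\<bar> - 1\<bar> * (\<bar>J k\<bar> + 1)" by (simp add: abs_mult)
      also have "\<dots> \<ge> \<bar>\<bar>J k\<bar> - 1\<bar> * 1" by (rule mult_left_mono) auto
      finally show ?thesis by simp
    qed
    ultimately show ?thesis using e by (metis order_trans)
  qed
  note J = this
  have "\<bar>\<Sum>k=1..n. J k\<bar> \<le> 1 / 4"
  proof -
    have "(\<Sum>k=1..n. J k) = Im (cnj (\<Sum>k=1..n. u k) * b)"
      by (simp add: R_J_def sum_distrib_right del: times_complex.sel)
    also have "\<bar>\<dots>\<bar> \<le> cmod (cnj (\<Sum>k=1..n. u k) * b)" by (rule abs_Im_le_cmod)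
    also have "\<dots> \<le> 1 / 4" using mean by (simp only: norm_mult b complex_mod_cnj)
    finally show ?thesis .
  qed
  moreover have "\<bar>(\<Sum>k=1..n. J k) - (\<Sum>k=1..n. sgn (J k))\<bar> \<le> 1 / 2"
  proof -
    have "\<bar>(\<Sum>k=1..n. J k) - (\<Sum>k=1..n. sgn (J k))\<bar> \<le> (\<Sum>k=1..n. \<bar>J k - sgn (J k)\<bar>)"
      by (simp flip: sum_subtractf)
    also have "\<dots> \<le> (\<Sum>k=1..n. 1 / (2 * real n))" using J by (intro sum_mono) auto
    finally show ?thesis using n by simp
  qed
  moreover have "\<bar>\<Sum>k=1..n. sgn (J k)\<bar> \<ge> 1"
  proof -
    define f where "f k = (if J k > 0 then 1 else -1 :: int)" for k
    have "(\<Sum>k=1..n. sgn (J k)) = of_int (\<Sum>k=1..n. f k)"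
      unfolding of_int_sum
    proof (intro sum.cong refl)
      fix k assume "k \<in> {1..n}"
      with J have "sgn (J k) \<in> {-1, 1}" by blast
      then show "sgn (J k) = of_int (f k)" by (cases "J k" "0::real" rule: linorder_cases) (simp_all add: f_def)
    qed
    moreover have "odd (\<Sum>k=1..n. f k)"
      using sum_of_signs_odd[of "{1..n}" f] \<open>odd n\<close> by (auto simp: f_def)
    then have "\<bar>\<Sum>k=1..n. f k\<bar> \<ge> 1" by presburger
    ultimately show ?thesis by (simp del: of_int_sum flip: of_int_abs)
  qed
  ultimately show False by linarith
qed

text \<open>A state of all agents with \<open>x\<close> the mean of the \<open>s k\<close> and \<open>B\<close> the mean of the \<open>\<rho> k * u k\<close>.\<close>
locale mean_state =
  fixes n :: nat and u s :: "nat \<Rightarrow> complex" and x B :: complex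
  assumes n: "n \<ge> 1"
    and x: "of_nat n * x = (\<Sum>k=1..n. s k)"
    and B: "of_nat n * B = (\<Sum>k=1..n. of_real (excess (u k)) * u k)"
begin

lemma sum_s: "(\<Sum>k=1..n. cnj (s k) * w) = of_nat n * (cnj x * w)"
proof -
  have "(\<Sum>k=1..n. cnj (s k) * w) = cnj (\<Sum>k=1..n. s k) * w" by (simp add: sum_distrib_right)
  then show ?thesis unfolding x[symmetric] by simp
qed

lemma sum_excess_u: "(\<Sum>k=1..n. of_real (excess (u k)) * (cnj (u k) * w)) = of_nat n * (cnj B * w)"
proof -
  have "(\<Sum>k=1..n. of_real (excess (u k)) * (cnj (u k) * w)) = cnj (\<Sum>k=1..n. of_real (excess (u k)) * u k) * w" 
    by (simp add: sum_distrib_right mult.assoc)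
  then show ?thesis unfolding B[symmetric] by simp
qed

lemma sum_excess_Re: "(\<Sum>k=1..n. excess (u k) * Re (cnj (u k) * w)) = real n * Re (cnj B * w)"
  using arg_cong[OF sum_excess_u[of w], of Re] by (simp add: algebra_simps)

lemma sum_excess_Im: "(\<Sum>k=1..n. excess (u k) * Im (cnj (u k) * w)) = real n * Im (cnj B * w)"
  using arg_cong[OF sum_excess_u[of w], of Im] by (simp add: algebra_simps)

lemma mean_norm_le: "real n * (cmod x)\<^sup>2 \<le> (\<Sum>k=1..n. (cmod (s k))\<^sup>2)"
proof -
  have "0 \<le> (\<Sum>k=1..n. (cmod (s k - x))\<^sup>2)" by (intro sum_nonneg) auto
  also have "\<dots> = (\<Sum>k=1..n. (cmod (s k))\<^sup>2 - 2 * Re (cnj (s k) * x) + (cmod x)\<^sup>2)"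
    unfolding cmod_power2 by (intro sum.cong) (auto simp: power2_eq_square algebra_simps)
  also have "\<dots> = (\<Sum>k=1..n. (cmod (s k))\<^sup>2) - 2 * Re (\<Sum>k=1..n. cnj (s k) * x) + real n * (cmod x)\<^sup>2"
    by (simp add: sum.distrib sum_subtractf sum_distrib_left del: times_complex.sel)
  also have "\<dots> = (\<Sum>k=1..n. (cmod (s k))\<^sup>2) - real n * (cmod x)\<^sup>2"
    unfolding sum_s cmod_power2 by (simp add: power2_eq_square algebra_simps)
  finally show ?thesis by linarith
qed

end

lemma (in mean_state) mean_B_le: 
  assumes "\<And>k. k \<in> {1..n} \<Longrightarrow> cmod (u k) \<le> 2"
  shows "real n * (cmod B)\<^sup>2 \<le> 4 * (\<Sum>k=1..n. (excess (u k))\<^sup>2)"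
proof -
  interpret B: mean_state n u "\<lambda>k. of_real (excess (u k)) * u k" B B
    using n B by unfold_locales auto
  have "(cmod (of_real (excess (u k)) * u k))\<^sup>2 \<le> 4 * (excess (u k))\<^sup>2" if "k \<in> {1..n}" for k
    using mult_left_mono[OF power_mono[OF assms[OF that], of 2], of "(excess (u k))\<^sup>2"]
    by (simp add: norm_mult power_mult_distrib mult.commute)
  then have "(\<Sum>k=1..n. (cmod (of_real (excess (u k)) * u k))\<^sup>2) \<le> (\<Sum>k=1..n. 4 * (excess (u k))\<^sup>2)"
    by (rule sum_mono)
  with B.mean_norm_le show ?thesis by (simp add: sum_distrib_left)
qed

text \<open>With \<open>c = x - \<i> B / A\<close> the right-hand side is \<open>n A^2 (Re (cnj c * x) - |c|^2)\<close>. As \<open>c\<close> is the mean of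
  \<open>w k = s k - \<i> \<rho> k * u k / A\<close>, convexity bounds \<open>n |c|^2\<close> by the sum of the \<open>|w k|^2\<close>, and what is left is
  an explicit expression for each agent. Its main term \<open>g^2 / 4\<close> is the dissipation in \<open>x\<close>.\<close>
lemma (in mean_state) mean_field_dissipation:
  assumes A: "A > 0"
  shows "A\<^sup>2 * (\<Sum>k=1..n. ((Re (cnj (u k) * x))\<^sup>2 - (defect (u k) (s k) x)\<^sup>2) / 4
      + Im (cnj (u k) * x) * skew A (u k) (s k) - (skew A (u k) (s k))\<^sup>2
      - excess (u k) * Re (cnj x * s k) + excess (u k) * (cmod (s k))\<^sup>2 - (excess (u k)) ^ 3 / A\<^sup>2)
    \<le> (\<Sum>k=1..n. excess (u k) * (A * Im (cnj (u k) * x) - Re (cnj (u k) * B)))"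
proof -
  define j where "j = 1 / A"
  define w where "w k = s k - \<i> * of_real j * (of_real (excess (u k)) * u k)" for k
  define c where "c = x - \<i> * of_real j * B"
  have wc: "of_nat n * c = (\<Sum>k=1..n. w k)"
    unfolding w_def sum_subtractf sum_distrib_left[symmetric] x[symmetric] B[symmetric]
    by (simp add: c_def algebra_simps)
  interpret w: mean_state n u w c B using n wc B by unfold_locales auto
  have per: "((Re (cnj (u k) * x))\<^sup>2 - (defect (u k) (s k) x)\<^sup>2) / 4
      + Im (cnj (u k) * x) * skew A (u k) (s k) - (skew A (u k) (s k))\<^sup>2
      - excess (u k) * Re (cnj x * s k) + excess (u k) * (cmod (s k))\<^sup>2 - (excess (u k)) ^ 3 / A\<^sup>2
     = Re (cnj (w k) * x) - (cmod (w k))\<^sup>2" for k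
  proof -
    define r p q g f R S where "r = excess (u k)" "p = Re (cnj (u k) * s k)" "q = Im (cnj (u k) * s k)"
      "g = Re (cnj (u k) * x)" "f = Im (cnj (u k) * x)" "R = Re (cnj x * s k)" "S = (cmod (s k))\<^sup>2"
    note d = this
    have u2: "1 + r = Re (u k) * Re (u k) + Im (u k) * Im (u k)" by (simp add: d excess_alt)
    have S2: "S = Re (s k) * Re (s k) + Im (s k) * Im (s k)" unfolding d cmod_power2 by (simp add: power2_eq_square)
    have h1: "Re (cnj (w k) * x) = R - j * r * f"
      by (simp add: w_def d algebra_simps)
    have "(cmod (w k))\<^sup>2 = S - 2 * j * r * q + j\<^sup>2 * r\<^sup>2 * (1 + r)"
      unfolding cmod_power2 S2 u2 unfolding w_def d(1)[symmetric] by (simp add: d(3) power2_eq_square algebra_simps)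
    moreover have "p * g + q * f = (1 + r) * R" "p * p + q * q = (1 + r) * S"
      unfolding u2 S2 by (simp_all add: d(2-6) algebra_simps)
    moreover have "r ^ 3 / A\<^sup>2 = r ^ 3 * j\<^sup>2" "skew A (u k) (s k) = q - r * j" "defect (u k) (s k) x = g - 2 * p" 
      by (simp_all add: skew_def defect_def d j_def power_divide)
    ultimately have "(g\<^sup>2 - (defect (u k) (s k) x)\<^sup>2) / 4
      + f * skew A (u k) (s k) - (skew A (u k) (s k))\<^sup>2 - r * R + r * S - r ^ 3 / A\<^sup>2
     = (R - j * r * f) - (cmod (w k))\<^sup>2"
      by (simp add: field_simps power2_eq_square power3_eq_cube) algebra
    then show ?thesis unfolding h1 d .
  qed
  have "(\<Sum>k=1..n. Re (cnj (w k) * x) - (cmod (w k))\<^sup>2) \<le> real n * Re (cnj c * x) - real n * (cmod c)\<^sup>2"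
    using w.mean_norm_le arg_cong[OF w.sum_s[of x], of Re] by (simp add: sum_subtractf)
  then have "A\<^sup>2 * (\<Sum>k=1..n. Re (cnj (w k) * x) - (cmod (w k))\<^sup>2) \<le> A\<^sup>2 * (real n * (Re (cnj c * x) - (cmod c)\<^sup>2))"
    by (intro mult_left_mono) (auto simp: algebra_simps)
  also have "\<dots> = real n * (A * Im (cnj B * x) - Re (cnj B * B))"
    unfolding cmod_power2 c_def j_def using A by (simp add: field_simps power2_eq_square)
  also have "\<dots> = (\<Sum>k=1..n. excess (u k) * (A * Im (cnj (u k) * x) - Re (cnj (u k) * B)))"
    using sum_excess_Im[of x] sum_excess_Re[of B]
    by (simp add: right_diff_distrib sum_subtractf mult.left_commute[of _ A] sum_distrib_left[symmetric] del: times_complex.sel)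
  finally show ?thesis unfolding per .
qed

section \<open>Negativity of the total rate\<close>

text \<open>The unknowns \<open>y\<close>, \<open>m\<close>, \<open>x\<close>, \<open>\<rho>\<close> determine \<open>s\<close>: \<open>p = (g - m) / 2\<close> and \<open>q = y + \<rho> / A\<close>.\<close>
lemma weighted_norm_lower:
  assumes A: "A > 0" and \<mu>: "0 < \<mu>" "\<mu> \<le> 1" and \<rho>: "\<bar>excess u\<bar> \<le> 1 / 2"
    and \<alpha>: "\<alpha> \<ge> 1" "\<alpha> \<ge> 1 / A"
  shows "\<mu> ^ 10 * ((excess u)\<^sup>2 + (cmod s)\<^sup>2) \<le> 5 * \<alpha>\<^sup>2 * weighted_norm A \<mu> u s x"
proof -
  define r y m p q g where "r = excess u" "y = skew A u s" "m = defect u s x"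
    "p = Re (cnj u * s)" "q = Im (cnj u * s)" "g = Re (cnj u * x)"
  note d = this
  define X where "X = (cmod x)\<^sup>2"
  have u2: "(cmod u)\<^sup>2 \<le> 2" using \<rho> unfolding excess_def by linarith
  have "g\<^sup>2 \<le> (cmod (cnj u * x))\<^sup>2" unfolding d using power_mono[OF abs_Re_le_cmod[of "cnj u * x"], of 2] by (simp del: times_complex.sel)
  also have "\<dots> = (cmod u)\<^sup>2 * X" by (simp add: norm_mult power_mult_distrib X_def)
  also have "\<dots> \<le> 2 * X" using u2 by (intro mult_right_mono) (auto simp: X_def)
  finally have g: "g\<^sup>2 \<le> 2 * X" .
  have "p\<^sup>2 + q\<^sup>2 = (cmod (cnj u * s))\<^sup>2" unfolding d cmod_power2 ..
  also have "\<dots> = (1 + r) * (cmod s)\<^sup>2" by (simp add: norm_mult power_mult_distrib d excess_def)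
  also have "\<dots> \<ge> (1 / 2) * (cmod s)\<^sup>2" using \<rho> d(1) by (intro mult_right_mono) auto
  finally have s: "(cmod s)\<^sup>2 \<le> 2 * p\<^sup>2 + 2 * q\<^sup>2" by linarith
  have "p = (g - m) / 2" by (simp add: d defect_def)
  then have "p\<^sup>2 = (g - m)\<^sup>2 / 4" by (simp only: power_divide) simp
  moreover have "(g - m)\<^sup>2 + (g + m)\<^sup>2 = 2 * g\<^sup>2 + 2 * m\<^sup>2" by (simp add: power2_eq_square algebra_simps)
  ultimately have p: "2 * p\<^sup>2 \<le> g\<^sup>2 + m\<^sup>2" using zero_le_power2[of "g + m"] by linarith
  have q1: "q = y + r / A" by (simp add: d skew_def)
  have "(y + r / A)\<^sup>2 + (y - r / A)\<^sup>2 = 2 * y\<^sup>2 + 2 * (r / A)\<^sup>2" by (simp add: power2_eq_square algebra_simps)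
  then have q: "q\<^sup>2 \<le> 2 * y\<^sup>2 + 2 * (r / A)\<^sup>2" using zero_le_power2[of "y - r / A"] unfolding q1 by linarith
  have "(1 / A)\<^sup>2 \<le> \<alpha>\<^sup>2" using \<alpha> A by (intro power_mono) auto
  from mult_left_mono[OF this, of "r\<^sup>2"] have rA: "(r / A)\<^sup>2 \<le> \<alpha>\<^sup>2 * r\<^sup>2" by (simp add: power_divide algebra_simps)
  have \<alpha>1: "Z \<le> \<alpha>\<^sup>2 * Z" if "Z \<ge> 0" for Z
    using mult_right_mono[OF one_le_power[OF \<alpha>(1), of 2] that] by simp
  have 1: "r\<^sup>2 + (cmod s)\<^sup>2 \<le> 5 * \<alpha>\<^sup>2 * (y\<^sup>2 + m\<^sup>2 + X + r\<^sup>2)"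
  proof -
    have "5 * \<alpha>\<^sup>2 * (y\<^sup>2 + m\<^sup>2 + X + r\<^sup>2) = 5 * (\<alpha>\<^sup>2 * y\<^sup>2) + 5 * (\<alpha>\<^sup>2 * m\<^sup>2) + 5 * (\<alpha>\<^sup>2 * X) + 5 * (\<alpha>\<^sup>2 * r\<^sup>2)"
      by (simp add: algebra_simps)
    moreover have "X \<ge> 0" by (simp add: X_def)
    ultimately show ?thesis
      using s p q rA g \<alpha>1[of "y\<^sup>2"] \<alpha>1[of "m\<^sup>2"] \<alpha>1[of X] \<alpha>1[of "r\<^sup>2"] 
        zero_le_power2[of y] zero_le_power2[of m] zero_le_power2[of r]
      by linarith
  qed
  have le: "\<mu> ^ 10 * Z\<^sup>2 \<le> (\<mu> ^ i * Z)\<^sup>2" if "i \<le> 5" for i Z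
    using \<mu> that power_decreasing[of "i * 2" 10 \<mu>] 
    by (auto simp: power_mult_distrib simp flip: power_mult intro!: mult_right_mono)
  have "\<mu> ^ 10 * (y\<^sup>2 + m\<^sup>2 + X + r\<^sup>2) \<le> weighted_norm A \<mu> u s x"
    using le[of 0 y] le[of 3 m] le[of 4 "cmod x"] le[of 5 r] 
    unfolding weighted_norm_def d[symmetric] X_def by (simp add: distrib_left)
  then have "5 * \<alpha>\<^sup>2 * (\<mu> ^ 10 * (y\<^sup>2 + m\<^sup>2 + X + r\<^sup>2)) \<le> 5 * \<alpha>\<^sup>2 * weighted_norm A \<mu> u s x"
    by (intro mult_left_mono) auto
  moreover have "\<mu> ^ 10 * (r\<^sup>2 + (cmod s)\<^sup>2) \<le> \<mu> ^ 10 * (5 * \<alpha>\<^sup>2 * (y\<^sup>2 + m\<^sup>2 + X + r\<^sup>2))"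
    using 1 \<mu> by (intro mult_left_mono) auto
  ultimately show ?thesis unfolding d(1) by (simp add: mult_ac)
qed

text \<open>In the lower bound of \<open>mean_field_dissipation\<close>, everything but \<open>g^2 / 4\<close> is negligible.\<close>
lemma mean_field_error:
  assumes A: "A > 0" and \<mu>: "0 < \<mu>" "\<mu> \<le> 1" and \<rho>: "\<bar>excess u\<bar> \<le> 1"
    and \<alpha>: "\<alpha> \<ge> 1" "\<alpha> \<ge> A" "\<alpha> \<ge> 1 / A"
    and a: "\<bar>excess u\<bar> \<le> a" "cmod s \<le> a" "cmod x \<le> a"
  shows "A\<^sup>2 * \<mu> ^ 8 * (Re (cnj u * x))\<^sup>2 / 4 - 3 * \<alpha>\<^sup>2 * \<mu> * weighted_norm A \<mu> u s x - 3 * \<alpha>\<^sup>2 * a ^ 3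
    \<le> \<mu> ^ 8 * (A\<^sup>2 * (((Re (cnj u * x))\<^sup>2 - (defect u s x)\<^sup>2) / 4
      + Im (cnj u * x) * skew A u s - (skew A u s)\<^sup>2
      - excess u * Re (cnj x * s) + excess u * (cmod s)\<^sup>2 - (excess u) ^ 3 / A\<^sup>2))"
proof -
  define r y m g f R where "r = excess u" "y = skew A u s" "m = defect u s x"
    "g = Re (cnj u * x)" "f = Im (cnj u * x)" "R = Re (cnj x * s)"
  note d = this
  define W where "W = weighted_norm A \<mu> u s x"
  have W: "W = y\<^sup>2 + (\<mu> ^ 3 * m)\<^sup>2 + (\<mu> ^ 4 * cmod x)\<^sup>2 + (\<mu> ^ 5 * r)\<^sup>2"
    by (simp add: W_def weighted_norm_def d)
  have a0: "a \<ge> 0" using a(2) norm_ge_zero[of s] by linarith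
  have A2: "A\<^sup>2 \<le> \<alpha>\<^sup>2" using A \<alpha> by (intro power_mono) auto
  have "\<mu> ^ 8 = \<mu>\<^sup>2 * (\<mu> ^ 3)\<^sup>2" by (simp flip: power_mult power_add)
  moreover have "\<mu>\<^sup>2 \<le> \<mu>" using \<mu> power_decreasing[of 1 2 \<mu>] by simp
  ultimately have t1: "\<mu> ^ 8 * m\<^sup>2 \<le> \<mu> * (\<mu> ^ 3 * m)\<^sup>2"
    using mult_right_mono[of "\<mu>\<^sup>2" \<mu> "(\<mu> ^ 3 * m)\<^sup>2"] by (simp add: power_mult_distrib mult.assoc)
  have "\<bar>y * f\<bar> \<le> \<bar>y\<bar> * (2 * cmod x)"
    unfolding d by (rule abs_mult_le[OF order_refl agent_bounds(3)[OF A \<rho> \<alpha> a]])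
  then have "\<mu> ^ 8 * \<bar>y * f\<bar> \<le> \<mu> ^ 8 * (\<bar>y\<bar> * (2 * cmod x))" using \<mu> by (intro mult_left_mono) auto
  also have "\<dots> \<le> \<mu> * (y\<^sup>2 + (\<mu> ^ 4 * cmod x)\<^sup>2)"
    using weighted_cross_term[OF \<mu>, of 0 4 8 y "cmod x"] by (simp add: abs_mult)
  finally have t2: "\<mu> ^ 8 * \<bar>y * f\<bar> \<le> \<mu> * (y\<^sup>2 + (\<mu> ^ 4 * cmod x)\<^sup>2)" .
  have t3: "\<mu> ^ 8 * y\<^sup>2 \<le> \<mu> * y\<^sup>2" using \<mu> power_decreasing[of 1 8 \<mu>] by (simp add: mult_right_mono)
  have "\<mu> ^ 8 * (m\<^sup>2 / 4 + \<bar>y * f\<bar> + y\<^sup>2) \<le> \<mu> * (3 * W)"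
  proof -
    have "\<mu> ^ 8 * (m\<^sup>2 / 4 + \<bar>y * f\<bar> + y\<^sup>2) \<le> \<mu> * ((\<mu> ^ 3 * m)\<^sup>2 / 4 + (y\<^sup>2 + (\<mu> ^ 4 * cmod x)\<^sup>2) + y\<^sup>2)"
      using t1 t2 t3 by (simp add: distrib_left)
    also have "\<dots> \<le> \<mu> * (3 * W)"
    proof (rule mult_left_mono)
      have "a / 4 + (b + c) + b \<le> 3 * (b + a + c + d)" if "a \<ge> 0" "b \<ge> 0" "c \<ge> 0" "d \<ge> 0" for a b c d :: real
        using that by simp
      then show "(\<mu> ^ 3 * m)\<^sup>2 / 4 + (y\<^sup>2 + (\<mu> ^ 4 * cmod x)\<^sup>2) + y\<^sup>2 \<le> 3 * W" unfolding W by simp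
    qed (use \<mu> in simp)
    finally show ?thesis .
  qed
  then have "A\<^sup>2 * (\<mu> ^ 8 * (m\<^sup>2 / 4 + \<bar>y * f\<bar> + y\<^sup>2)) \<le> A\<^sup>2 * (\<mu> * (3 * W))"
    by (intro mult_left_mono) auto
  also have "\<dots> \<le> \<alpha>\<^sup>2 * (\<mu> * (3 * W))" using A2 \<mu> by (intro mult_right_mono) (auto simp: W)
  finally have quad: "A\<^sup>2 * \<mu> ^ 8 * (m\<^sup>2 / 4 + \<bar>y * f\<bar> + y\<^sup>2) \<le> 3 * \<alpha>\<^sup>2 * \<mu> * W" by (simp add: mult_ac)
  define C where "C = A\<^sup>2 * (- (r * R) + r * (cmod s)\<^sup>2) - r ^ 3"
  have "\<bar>R\<bar> \<le> cmod (cnj x * s)" unfolding d by (rule abs_Re_le_cmod)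
  also have "\<dots> \<le> a * a" using a a0 by (simp add: norm_mult mult_mono)
  finally have "\<bar>r * R\<bar> \<le> a * (a * a)" unfolding d(1) by (rule abs_mult_le[OF a(1)])
  moreover have "\<bar>r * (cmod s * cmod s)\<bar> \<le> a * (a * a)" unfolding d
    by (intro abs_mult_le a) (use a in auto)
  ultimately have "\<bar>- (r * R) + r * (cmod s)\<^sup>2\<bar> \<le> 2 * (a * (a * a))" unfolding power2_eq_square by linarith
  with A2 have "\<bar>A\<^sup>2 * (- (r * R) + r * (cmod s)\<^sup>2)\<bar> \<le> \<alpha>\<^sup>2 * (2 * (a * (a * a)))" by (intro abs_mult_le) auto
  moreover have "\<bar>r * (r * r)\<bar> \<le> a * (a * a)" unfolding d by (intro abs_mult_le a)
  moreover have "a * (a * a) \<le> \<alpha>\<^sup>2 * (a * (a * a))" using mult_right_mono[OF one_le_power[OF \<alpha>(1), of 2], of "a * (a * a)"] a0 by simp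
  ultimately have C: "\<bar>C\<bar> \<le> 3 * \<alpha>\<^sup>2 * a ^ 3" unfolding C_def power3_eq_cube mult.assoc by linarith
  have "\<bar>\<mu> ^ 8 * C\<bar> \<le> 1 * (3 * \<alpha>\<^sup>2 * a ^ 3)" using \<mu> by (intro abs_mult_le C) (auto intro: power_le_one)
  moreover have "A\<^sup>2 * \<mu> ^ 8 * (f * y) \<ge> - (A\<^sup>2 * \<mu> ^ 8 * \<bar>y * f\<bar>)"
  proof -
    have "A\<^sup>2 * \<mu> ^ 8 * (- (f * y)) \<le> A\<^sup>2 * \<mu> ^ 8 * \<bar>y * f\<bar>"
      using \<mu> abs_ge_minus_self[of "y * f"] by (intro mult_left_mono) (auto simp: mult.commute)
    then show ?thesis by simp
  qed
  moreover have "\<mu> ^ 8 * (A\<^sup>2 * ((g\<^sup>2 - m\<^sup>2) / 4 + f * y - y\<^sup>2 - r * R + r * (cmod s)\<^sup>2 - r ^ 3 / A\<^sup>2))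
    = A\<^sup>2 * \<mu> ^ 8 * g\<^sup>2 / 4 - A\<^sup>2 * \<mu> ^ 8 * (m\<^sup>2 / 4 + \<bar>y * f\<bar> + y\<^sup>2) + A\<^sup>2 * \<mu> ^ 8 * \<bar>y * f\<bar> + A\<^sup>2 * \<mu> ^ 8 * (f * y) + \<mu> ^ 8 * C"
    using A by (simp add: C_def field_simps)
  ultimately show ?thesis using quad unfolding d[symmetric] W_def[symmetric] by linarith
qed

text \<open>The smallest of the dissipation coefficients of \<open>y\<close>, \<open>m\<close> and \<open>x\<close> (that of \<open>\<rho>\<close> is 2) with respect
  to \<open>weighted_norm\<close>.\<close>
definition contraction :: "nat \<Rightarrow> real \<Rightarrow> real"
  where "contraction n A = min 1 (min A (A\<^sup>2 / (16 * (real n)\<^sup>2)))"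

lemma cube_sum3_le:
  fixes a b c \<nu> :: real
  assumes "0 \<le> a" "0 \<le> b" "0 \<le> c" "a \<le> \<nu>" "b \<le> \<nu>" "c \<le> \<nu>"
  shows "(a + b + c)\<^sup>2 \<le> 3 * (a\<^sup>2 + b\<^sup>2 + c\<^sup>2)" "(a + b + c) ^ 3 \<le> 9 * \<nu> * (a\<^sup>2 + b\<^sup>2 + c\<^sup>2)"
proof -
  have "3 * (a\<^sup>2 + b\<^sup>2 + c\<^sup>2) - (a + b + c)\<^sup>2 = (a - b)\<^sup>2 + (b - c)\<^sup>2 + (a - c)\<^sup>2"
    by (simp add: power2_eq_square algebra_simps)
  then show 1: "(a + b + c)\<^sup>2 \<le> 3 * (a\<^sup>2 + b\<^sup>2 + c\<^sup>2)"
    using zero_le_power2[of "a - b"] zero_le_power2[of "b - c"] zero_le_power2[of "a - c"] by linarith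
  have "(a + b + c) ^ 3 = (a + b + c) * (a + b + c)\<^sup>2" by (simp add: power3_eq_cube power2_eq_square)
  also have "\<dots> \<le> (3 * \<nu>) * (3 * (a\<^sup>2 + b\<^sup>2 + c\<^sup>2))" using assms 1 by (intro mult_mono) auto
  finally show "(a + b + c) ^ 3 \<le> 9 * \<nu> * (a\<^sup>2 + b\<^sup>2 + c\<^sup>2)" by (simp add: algebra_simps)
qed

text \<open>The squared size of the deviation from the family of rotating states.\<close>
definition deviation :: "nat \<Rightarrow> (nat \<Rightarrow> complex) \<Rightarrow> (nat \<Rightarrow> complex) \<Rightarrow> real"
  where "deviation n u s = (\<Sum>k=1..n. (excess (u k))\<^sup>2 + (cmod (s k))\<^sup>2)"

text \<open>A state close to the family: all \<open>|\<rho> k|\<close> and \<open>|s k|\<close> are at most \<open>\<nu>\<close>. The assumption \<open>mean_u\<close> expresses that the \<open>z k\<close> sum to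
  zero.\<close>
locale near_state = mean_state +
  fixes A \<alpha> \<mu> \<nu> :: real
  assumes A: "A > 0" and odd: "odd n"
    and mean_u: "(\<Sum>k=1..n. u k) = (\<Sum>k=1..n. s k)"
    and \<mu>: "0 < \<mu>" "\<mu> \<le> 1"
    and \<alpha>: "\<alpha> \<ge> 1" "\<alpha> \<ge> A" "\<alpha> \<ge> 1 / A"
    and \<nu>: "0 < \<nu>" "\<nu> \<le> 1 / (4 * real n)"
    and near: "\<And>k. k \<in> {1..n} \<Longrightarrow> \<bar>excess (u k)\<bar> \<le> \<nu>" "\<And>k. k \<in> {1..n} \<Longrightarrow> cmod (s k) \<le> \<nu>"
begin

text \<open>The size \<open>a\<close> used in the estimates for agent \<open>k\<close>.\<close>
definition magnitude :: "nat \<Rightarrow> real" where "magnitude k = \<bar>excess (u k)\<bar> + cmod (s k) + cmod x"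

lemma \<nu>_le: "\<nu> \<le> 1 / 4"
proof -
  have "1 / (4 * real n) \<le> 1 / 4" using n by (simp add: field_simps)
  with \<nu> show ?thesis by linarith
qed

lemma x_le: "cmod x \<le> \<nu>"
proof -
  have "real n * cmod x = cmod (\<Sum>k=1..n. s k)" unfolding x[symmetric] by (simp add: norm_mult)
  also have "\<dots> \<le> (\<Sum>k=1..n. \<nu>)" by (rule sum_norm_le) (use near in auto)
  finally show ?thesis using n by (simp add: mult_le_cancel_left)
qed

lemma magnitude_le: "\<bar>excess (u k)\<bar> \<le> magnitude k" "cmod (s k) \<le> magnitude k" "cmod x \<le> magnitude k"
  by (auto simp: magnitude_def)

lemma excess_le1: "k \<in> {1..n} \<Longrightarrow> \<bar>excess (u k)\<bar> \<le> 1"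
  using near(1)[of k] \<nu>_le by linarith

lemma magnitude_sums: "(\<Sum>k=1..n. (magnitude k)\<^sup>2) \<le> 6 * deviation n u s" "(\<Sum>k=1..n. magnitude k ^ 3) \<le> 18 * \<nu> * deviation n u s"
proof -
  have le: "(\<Sum>k=1..n. (excess (u k))\<^sup>2 + (cmod (s k))\<^sup>2 + (cmod x)\<^sup>2) \<le> 2 * deviation n u s"
    using mean_norm_le sum_nonneg[of "{1..n}" "\<lambda>k. (excess (u k))\<^sup>2"] by (simp add: deviation_def sum.distrib)
  have "(\<Sum>k=1..n. (magnitude k)\<^sup>2) \<le> (\<Sum>k=1..n. 3 * ((excess (u k))\<^sup>2 + (cmod (s k))\<^sup>2 + (cmod x)\<^sup>2))"
    unfolding magnitude_def using cube_sum3_le(1)[of "\<bar>excess (u k)\<bar>" "cmod (s k)" "cmod x" \<nu> for k] near x_le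
    by (intro sum_mono) simp
  also have "\<dots> \<le> 3 * (2 * deviation n u s)" unfolding sum_distrib_left[symmetric] using le by simp
  finally show "(\<Sum>k=1..n. (magnitude k)\<^sup>2) \<le> 6 * deviation n u s" by simp
  have "(\<Sum>k=1..n. magnitude k ^ 3) \<le> (\<Sum>k=1..n. 9 * \<nu> * ((excess (u k))\<^sup>2 + (cmod (s k))\<^sup>2 + (cmod x)\<^sup>2))"
    unfolding magnitude_def using cube_sum3_le(2)[of "\<bar>excess (u k)\<bar>" "cmod (s k)" "cmod x" \<nu> for k] near x_le
    by (intro sum_mono) simp
  also have "\<dots> \<le> 9 * \<nu> * (2 * deviation n u s)" unfolding sum_distrib_left[symmetric] using le \<nu> by (intro mult_left_mono) auto
  finally show "(\<Sum>k=1..n. magnitude k ^ 3) \<le> 18 * \<nu> * deviation n u s" by simp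
qed

lemma mean_noncollinear: "(cmod x)\<^sup>2 / (4 * real n) \<le> (\<Sum>k=1..n. (Re (cnj (u k) * x))\<^sup>2)"
proof (rule odd_balanced_noncollinear)
  show "odd n" by (rule odd)
  show "\<bar>excess (u k)\<bar> \<le> 1 / (4 * real n)" if "k \<in> {1..n}" for k using near(1)[OF that] \<nu> by linarith
  have "cmod (\<Sum>k=1..n. u k) = real n * cmod x" unfolding mean_u x[symmetric] by (simp add: norm_mult)
  also have "\<dots> \<le> real n * (1 / (4 * real n))" using x_le \<nu> by (intro mult_left_mono) auto
  finally show "cmod (\<Sum>k=1..n. u k) \<le> 1 / 4" using n by simp
qed

lemma lyap_rate_sum_le:
  assumes small: "93 * \<alpha>\<^sup>2 * \<mu> \<le> contraction n A / 2"
  shows "(\<Sum>k=1..n. lyap_rate A \<mu> (u k) (s k) x B)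
    \<le> (2000 * \<alpha>\<^sup>2 * \<nu> - contraction n A * \<mu> ^ 10 / (10 * \<alpha>\<^sup>2)) * deviation n u s"
proof -
  define c where "c = contraction n A"
  have c: "c \<le> 1" "c \<le> A" "c \<le> A\<^sup>2 / (16 * (real n)\<^sup>2)" "c > 0" 
    using A n by (auto simp: c_def contraction_def)
  define W where "W k = weighted_norm A \<mu> (u k) (s k) x" for k
  have \<alpha>2: "\<alpha> \<le> \<alpha>\<^sup>2" "1 \<le> \<alpha>\<^sup>2" 
    using \<alpha>(1) power_increasing[of 1 2 \<alpha>] one_le_power[of \<alpha> 2] by simp_all
  \<comment> \<open>The terms of the rate which vanish, or have a sign, only after summation.\<close>
  have D0: "(\<Sum>k=1..n. Im (cnj (s k) * x)) = 0"
    using arg_cong[OF sum_s[of x], of Im] by (simp add: algebra_simps)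
  have G0: "(\<Sum>k=1..n. Re (cnj x * B) - excess (u k) * Re (cnj (u k) * x)) = 0"
    unfolding sum_subtractf sum_excess_Re by (simp add: algebra_simps)
  have J0: "(\<Sum>k=1..n. excess (u k) * Re (cnj (u k) * B)) \<ge> 0"
    unfolding sum_excess_Re by simp
  define H where "H k = excess (u k) * (A * Im (cnj (u k) * x) - Re (cnj (u k) * B))" for k
  define E where "E k = A\<^sup>2 * \<mu> ^ 8 * (Re (cnj (u k) * x))\<^sup>2 / 4 - 3 * \<alpha>\<^sup>2 * \<mu> * W k - 3 * \<alpha>\<^sup>2 * magnitude k ^ 3" for k
  have "(\<Sum>k=1..n. E k) \<le> \<mu> ^ 8 * (\<Sum>k=1..n. H k)"
  proof -
    have "(\<Sum>k=1..n. E k) \<le> \<mu> ^ 8 * (A\<^sup>2 * (\<Sum>k=1..n. ((Re (cnj (u k) * x))\<^sup>2 - (defect (u k) (s k) x)\<^sup>2) / 4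
      + Im (cnj (u k) * x) * skew A (u k) (s k) - (skew A (u k) (s k))\<^sup>2
      - excess (u k) * Re (cnj x * s k) + excess (u k) * (cmod (s k))\<^sup>2 - (excess (u k)) ^ 3 / A\<^sup>2))"
      unfolding sum_distrib_left E_def W_def
      by (intro sum_mono mean_field_error A \<mu> \<alpha> excess_le1 magnitude_le)
    also have "\<dots> \<le> \<mu> ^ 8 * (\<Sum>k=1..n. H k)"
      unfolding H_def using \<mu> by (intro mult_left_mono mean_field_dissipation A) auto
    finally show ?thesis .
  qed
  note E_le = this
  have X: "c * (\<Sum>k=1..n. (\<mu> ^ 4 * cmod x)\<^sup>2) \<le> (\<Sum>k=1..n. A\<^sup>2 * \<mu> ^ 8 * (Re (cnj (u k) * x))\<^sup>2 / 4)"
  proof -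
    have "c * (\<Sum>k=1..n. (\<mu> ^ 4 * cmod x)\<^sup>2) \<le> A\<^sup>2 / (16 * (real n)\<^sup>2) * (\<Sum>k=1..n. (\<mu> ^ 4 * cmod x)\<^sup>2)"
      using c by (intro mult_right_mono) auto
    also have "\<dots> = A\<^sup>2 * \<mu> ^ 8 / 4 * ((cmod x)\<^sup>2 / (4 * real n))"
      using n by (simp add: power_mult_distrib field_simps power2_eq_square flip: power_mult power_add)
    also have "\<dots> \<le> A\<^sup>2 * \<mu> ^ 8 / 4 * (\<Sum>k=1..n. (Re (cnj (u k) * x))\<^sup>2)"
      using \<mu> by (intro mult_left_mono mean_noncollinear) auto
    finally show ?thesis by (simp add: sum_distrib_left)
  qed
  define Y M R X2 where "Y = (\<Sum>k=1..n. (skew A (u k) (s k))\<^sup>2)" "M = (\<Sum>k=1..n. (\<mu> ^ 3 * defect (u k) (s k) x)\<^sup>2)"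
    "R = (\<Sum>k=1..n. (\<mu> ^ 5 * excess (u k))\<^sup>2)" "X2 = (\<Sum>k=1..n. (\<mu> ^ 4 * cmod x)\<^sup>2)"
  note S = this
  have S0: "Y \<ge> 0" "M \<ge> 0" "R \<ge> 0" "X2 \<ge> 0" unfolding S by (intro sum_nonneg; simp)+
  have Wsum: "(\<Sum>k=1..n. W k) = Y + M + X2 + R"
    by (simp add: W_def weighted_norm_def S sum.distrib)
  define T where "T = (\<Sum>k=1..n. magnitude k ^ 3)"
  have Bsum: "real n * (\<mu> ^ 5 * cmod B)\<^sup>2 \<le> 4 * R"
  proof -
    have "real n * (\<mu> ^ 5 * cmod B)\<^sup>2 = \<mu> ^ 10 * (real n * (cmod B)\<^sup>2)" 
      by (simp add: power_mult_distrib flip: power_mult)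
    also have "\<dots> \<le> \<mu> ^ 10 * (4 * (\<Sum>k=1..n. (excess (u k))\<^sup>2))"
      using \<mu> by (intro mult_left_mono mean_B_le agent_bounds(1)[OF A excess_le1 \<alpha> magnitude_le]) auto
    also have "\<dots> = 4 * R" by (simp add: S power_mult_distrib sum_distrib_left mult.left_commute flip: power_mult)
    finally show ?thesis .
  qed
  have "(\<Sum>k=1..n. lyap_rate A \<mu> (u k) (s k) x B) \<le> (\<Sum>k=1..n. 
      - (skew A (u k) (s k))\<^sup>2 - A * (\<mu> ^ 3 * defect (u k) (s k) x)\<^sup>2 - 2 * (\<mu> ^ 5 * excess (u k))\<^sup>2
      + 18 * \<alpha> * \<mu> * (W k + (\<mu> ^ 5 * cmod B)\<^sup>2) + 100 * \<alpha>\<^sup>2 * magnitude k ^ 3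
      - A * Im (cnj (s k) * x) + (Re (cnj x * B) - excess (u k) * Re (cnj (u k) * x)) / 2
      - \<mu> ^ 8 * H k - \<mu> ^ 10 * (excess (u k) * Re (cnj (u k) * B)))"
    unfolding W_def H_def by (intro sum_mono lyap_rate_bound A \<mu> \<alpha> excess_le1 magnitude_le)
  also have "\<dots> = - Y - A * M - 2 * R + 18 * \<alpha> * \<mu> * ((\<Sum>k=1..n. W k) + real n * (\<mu> ^ 5 * cmod B)\<^sup>2)
      + 100 * \<alpha>\<^sup>2 * T - A * (\<Sum>k=1..n. Im (cnj (s k) * x)) 
      + (\<Sum>k=1..n. Re (cnj x * B) - excess (u k) * Re (cnj (u k) * x)) / 2
      - \<mu> ^ 8 * (\<Sum>k=1..n. H k) - \<mu> ^ 10 * (\<Sum>k=1..n. excess (u k) * Re (cnj (u k) * B))"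
    unfolding S T_def
    by (simp only: sum.distrib sum_subtractf sum_negf sum_distrib_left[symmetric] sum_divide_distrib[symmetric])
      (simp add: sum_subtractf)
  also have "\<dots> \<le> - Y - A * M - 2 * R + 18 * \<alpha> * \<mu> * ((\<Sum>k=1..n. W k) + 4 * R)
      + 100 * \<alpha>\<^sup>2 * T - (\<Sum>k=1..n. E k)"
  proof -
    have "18 * \<alpha> * \<mu> * ((\<Sum>k=1..n. W k) + real n * (\<mu> ^ 5 * cmod B)\<^sup>2) \<le> 18 * \<alpha> * \<mu> * ((\<Sum>k=1..n. W k) + 4 * R)"
      using \<mu> \<alpha> Bsum by (intro mult_left_mono) auto
    moreover have "\<mu> ^ 10 * (\<Sum>k=1..n. excess (u k) * Re (cnj (u k) * B)) \<ge> 0" using J0 \<mu> by simp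
    ultimately show ?thesis using E_le D0 G0 by simp
  qed
  also have "\<dots> \<le> - c * (Y + M + X2 + R) + 93 * \<alpha>\<^sup>2 * \<mu> * (Y + M + X2 + R) + 103 * \<alpha>\<^sup>2 * T"
  proof -
    have "(\<Sum>k=1..n. E k) = (\<Sum>k=1..n. A\<^sup>2 * \<mu> ^ 8 * (Re (cnj (u k) * x))\<^sup>2 / 4) 
        - 3 * \<alpha>\<^sup>2 * \<mu> * (\<Sum>k=1..n. W k) - 3 * \<alpha>\<^sup>2 * T"
      by (simp add: E_def T_def sum_subtractf sum_distrib_left)
    moreover have "18 * \<alpha> * \<mu> * ((\<Sum>k=1..n. W k) + 4 * R) \<le> 90 * \<alpha>\<^sup>2 * \<mu> * (Y + M + X2 + R)"
    proof -
      have "18 * \<alpha> * \<mu> * ((\<Sum>k=1..n. W k) + 4 * R) \<le> 18 * \<alpha>\<^sup>2 * \<mu> * (5 * (Y + M + X2 + R))"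
        using \<mu> \<alpha>2 S0 \<alpha> unfolding Wsum by (intro mult_mono) auto
      also have "\<dots> = 90 * \<alpha>\<^sup>2 * \<mu> * (Y + M + X2 + R)" by simp
      finally show ?thesis .
    qed
    moreover have "c * Y \<le> Y" "c * M \<le> A * M" "c * R \<le> 2 * R"
      using c S0 mult_right_mono[of c 1 Y] mult_right_mono[of c A M] mult_right_mono[of c 2 R] by simp_all
    moreover have "3 * \<alpha>\<^sup>2 * \<mu> * (\<Sum>k=1..n. W k) + 90 * \<alpha>\<^sup>2 * \<mu> * (Y + M + X2 + R) = 93 * \<alpha>\<^sup>2 * \<mu> * (Y + M + X2 + R)" 
      unfolding Wsum by (simp add: distrib_left)
    moreover have "c * (Y + M + X2 + R) = c * Y + c * M + c * X2 + c * R" by (simp add: distrib_left)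
    ultimately show ?thesis using X unfolding S(4)[symmetric] by linarith
  qed
  also have "\<dots> \<le> - (c / 2) * (Y + M + X2 + R) + 103 * \<alpha>\<^sup>2 * T"
    using mult_right_mono[OF small, of "Y + M + X2 + R"] S0 unfolding c_def[symmetric] by simp
  also have "\<dots> \<le> - (c / 2) * (\<mu> ^ 10 / (5 * \<alpha>\<^sup>2) * deviation n u s) + 103 * \<alpha>\<^sup>2 * (18 * \<nu> * deviation n u s)"
  proof -
    have "\<mu> ^ 10 * deviation n u s \<le> (\<Sum>k=1..n. 5 * \<alpha>\<^sup>2 * W k)"
      unfolding W_def deviation_def sum_distrib_left 
      by (intro sum_mono weighted_norm_lower A \<mu> \<alpha>) (use near(1) \<nu>_le in force)
    then have "\<mu> ^ 10 * deviation n u s \<le> 5 * \<alpha>\<^sup>2 * (Y + M + X2 + R)" by (simp only: Wsum flip: sum_distrib_left)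
    moreover have c5: "0 < 5 * \<alpha>\<^sup>2" using \<alpha>2 by linarith
    ultimately have "\<mu> ^ 10 / (5 * \<alpha>\<^sup>2) * deviation n u s \<le> Y + M + X2 + R"
      using \<alpha>2 by (simp add: pos_divide_le_eq[OF c5] mult.commute)
    then have "(c / 2) * (\<mu> ^ 10 / (5 * \<alpha>\<^sup>2) * deviation n u s) \<le> (c / 2) * (Y + M + X2 + R)"
      using c by (intro mult_left_mono) auto
    moreover have "103 * \<alpha>\<^sup>2 * T \<le> 103 * \<alpha>\<^sup>2 * (18 * \<nu> * deviation n u s)" 
      using magnitude_sums(2) unfolding T_def by (intro mult_left_mono) auto
    ultimately show ?thesis unfolding mult_minus_left by linarith
  qed
  also have "\<dots> \<le> (2000 * \<alpha>\<^sup>2 * \<nu> - c * \<mu> ^ 10 / (10 * \<alpha>\<^sup>2)) * deviation n u s"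
  proof -
    have "0 \<le> \<alpha>\<^sup>2 * (\<nu> * deviation n u s)" using \<nu> by (auto simp: deviation_def intro!: mult_nonneg_nonneg sum_nonneg)
    then show ?thesis by (simp add: algebra_simps)
  qed
  finally show ?thesis unfolding c_def .
qed

end

section \<open>Coercivity of the Lyapunov function\<close>

text \<open>A constant such that the Lyapunov function is at least this multiple of the deviation.\<close>
definition coercivity :: "nat \<Rightarrow> real \<Rightarrow> real"
  where "coercivity n \<alpha> = 1 / (16384 * (real n)\<^sup>2 * \<alpha>\<^sup>2)"

lemma cross_terms_le:
  assumes A: "A > 0" and \<mu>: "0 < \<mu>" "\<mu> \<le> 1" and \<rho>: "\<bar>excess u\<bar> \<le> 1"
    and \<alpha>: "\<alpha> \<ge> 1" "\<alpha> \<ge> A" "\<alpha> \<ge> 1 / A"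
    and a: "\<bar>excess u\<bar> \<le> a" "cmod s \<le> a" "cmod x \<le> a"
  shows "\<bar>\<mu> ^ 6 * (skew A u s * defect u s x) + \<mu> ^ 8 * (excess u * Re (cnj u * x))
    - \<mu> ^ 10 * (defect u s x * excess u)\<bar> \<le> 26 * \<alpha> * \<mu> * a\<^sup>2"
proof -
  note b = agent_bounds[OF A \<rho> \<alpha> a]
  have a0: "a \<ge> 0" using a(2) norm_ge_zero[of s] by linarith
  have g: "\<bar>Re (cnj u * x)\<bar> \<le> 2 * a" by (rule order_trans[OF b(2)]) (use a in simp)
  have pw: "\<bar>\<mu> ^ k\<bar> \<le> \<mu>" if "k \<ge> 1" for k
    using \<mu> that power_decreasing[of 1 k \<mu>] by simp
  have "\<bar>\<mu> ^ 6 * (skew A u s * defect u s x)\<bar> \<le> \<mu> * (3 * \<alpha> * a * (6 * a))"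
    "\<bar>\<mu> ^ 8 * (excess u * Re (cnj u * x))\<bar> \<le> \<mu> * (a * (2 * a))"
    "\<bar>\<mu> ^ 10 * (defect u s x * excess u)\<bar> \<le> \<mu> * (6 * a * a)"
    by (intro abs_mult_le b g a pw; simp)+
  moreover have "\<mu> * (3 * \<alpha> * a * (6 * a)) = 18 * (\<alpha> * \<mu> * a\<^sup>2)" "\<mu> * (a * (2 * a)) = 2 * (\<mu> * a\<^sup>2)" 
      "\<mu> * (6 * a * a) = 6 * (\<mu> * a\<^sup>2)" "26 * \<alpha> * \<mu> * a\<^sup>2 = 26 * (\<alpha> * \<mu> * a\<^sup>2)"
    by (simp_all add: power2_eq_square)
  moreover have "\<mu> * a\<^sup>2 \<le> \<alpha> * \<mu> * a\<^sup>2"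
    using mult_right_mono[OF \<alpha>(1), of "\<mu> * a\<^sup>2"] \<mu> by simp
  ultimately show ?thesis by linarith
qed

context near_state
begin

lemma lyap_sum_eq:
  "(\<Sum>k=1..n. lyap A \<mu> (u k) (s k) x) = (\<Sum>k=1..n. ((Re (cnj (u k) * s k))\<^sup>2 + (skew A (u k) (s k))\<^sup>2
      + (cmod (s k - x))\<^sup>2 - excess (u k) * (cmod (s k))\<^sup>2) / 4
    - (\<mu> ^ 6 * (skew A (u k) (s k) * defect (u k) (s k) x) + \<mu> ^ 8 * (excess (u k) * Re (cnj (u k) * x))
    - \<mu> ^ 10 * (defect (u k) (s k) x * excess (u k))))"
proof -
  have per: "lyap A \<mu> (u k) (s k) x = ((Re (cnj (u k) * s k))\<^sup>2 + (skew A (u k) (s k))\<^sup>2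
      + (cmod (s k - x))\<^sup>2 - excess (u k) * (cmod (s k))\<^sup>2) / 4
    - (\<mu> ^ 6 * (skew A (u k) (s k) * defect (u k) (s k) x) + \<mu> ^ 8 * (excess (u k) * Re (cnj (u k) * x))
    - \<mu> ^ 10 * (defect (u k) (s k) x * excess (u k)))
    + (Re (cnj (s k) * x) - (cmod x)\<^sup>2) / 2" for k
  proof -
    define r p q where "r = excess (u k)" "p = Re (cnj (u k) * s k)" "q = Im (cnj (u k) * s k)"
    note d = this
    have "p\<^sup>2 + q\<^sup>2 = (cmod (cnj (u k) * s k))\<^sup>2" unfolding d cmod_power2 ..
    then have pq: "p\<^sup>2 = (1 + r) * (cmod (s k))\<^sup>2 - q\<^sup>2" by (simp add: norm_mult power_mult_distrib d excess_def)
    have sx: "(cmod (s k - x))\<^sup>2 = (cmod (s k))\<^sup>2 - 2 * Re (cnj (s k) * x) + (cmod x)\<^sup>2"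
      unfolding cmod_power2 by (simp add: power2_eq_square algebra_simps)
    have y: "skew A (u k) (s k) = q - r / A" by (simp add: skew_def d)
    have "(cmod (s k))\<^sup>2 / 2 - (cmod x)\<^sup>2 / 4 + r\<^sup>2 / (4 * A\<^sup>2) - r * q / (2 * A)
      = (p\<^sup>2 + (q - r / A)\<^sup>2 + (cmod (s k - x))\<^sup>2 - r * (cmod (s k))\<^sup>2) / 4 + (Re (cnj (s k) * x) - (cmod x)\<^sup>2) / 2"
      unfolding pq sx using A by (simp add: field_simps power2_eq_square del: times_complex.sel)
    then show ?thesis unfolding lyap_def d[symmetric] y by linarith
  qed
  have "(\<Sum>k=1..n. (Re (cnj (s k) * x) - (cmod x)\<^sup>2) / 2) = 0"
  proof -
    have "(\<Sum>k=1..n. Re (cnj (s k) * x)) = real n * (cmod x)\<^sup>2"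
      using arg_cong[OF sum_s[of x], of Re] unfolding cmod_power2 by (simp add: power2_eq_square)
    then show ?thesis by (simp add: sum_subtractf flip: sum_divide_distrib del: times_complex.sel)
  qed
  then show ?thesis unfolding per sum.distrib by simp
qed

text \<open>This is positivity of \<open>W\<close>. By noncollinearity \<open>p\<close> and \<open>s - x\<close> control \<open>x\<close>, since
  \<open>g = p - Re (cnj u * (s - x))\<close>; they then control \<open>s\<close>, and with \<open>y\<close> also \<open>\<rho>\<close>.\<close>
lemma energy_lower:
  "8 * coercivity n \<alpha> * deviation n u s
    \<le> (\<Sum>k=1..n. (Re (cnj (u k) * s k))\<^sup>2 + (skew A (u k) (s k))\<^sup>2 + (cmod (s k - x))\<^sup>2)"
proof -
  define \<kappa> where "\<kappa> = 1 / (64 * (real n)\<^sup>2)"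
  have "(real n)\<^sup>2 \<ge> 1" using n by (intro one_le_power) simp
  moreover have "n > 0" using n by linarith
  ultimately have "\<kappa> \<le> 1 / (64 * 1)" unfolding \<kappa>_def by (intro divide_left_mono) auto
  then have "\<kappa> \<le> 1 / 2" by linarith
  moreover have "0 < \<kappa>" using \<open>n > 0\<close> by (simp add: \<kappa>_def)
  ultimately have \<kappa>: "0 < \<kappa>" "\<kappa> \<le> 1 / 2" by blast+
  define P Y D G S R where "P = (\<Sum>k=1..n. (Re (cnj (u k) * s k))\<^sup>2)" "Y = (\<Sum>k=1..n. (skew A (u k) (s k))\<^sup>2)"
    "D = (\<Sum>k=1..n. (cmod (s k - x))\<^sup>2)" "G = (\<Sum>k=1..n. (Re (cnj (u k) * x))\<^sup>2)"
    "S = (\<Sum>k=1..n. (cmod (s k))\<^sup>2)" "R = (\<Sum>k=1..n. (excess (u k))\<^sup>2)"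
  note d = this
  have pos: "P \<ge> 0" "Y \<ge> 0" "D \<ge> 0" "G \<ge> 0" "S \<ge> 0" "R \<ge> 0" unfolding d by (intro sum_nonneg; simp)+
  have sq2: "(a + b)\<^sup>2 \<le> 2 * a\<^sup>2 + 2 * b\<^sup>2" for a b :: real
  proof -
    have "(a + b)\<^sup>2 + (a - b)\<^sup>2 = 2 * a\<^sup>2 + 2 * b\<^sup>2" by (simp add: power2_eq_square algebra_simps)
    then show ?thesis using zero_le_power2[of "a - b"] by linarith
  qed
  have bd: "cmod (u k) \<le> 2" "\<bar>Re (cnj (u k) * w)\<bar> \<le> 2 * cmod w" "\<bar>Im (cnj (u k) * w)\<bar> \<le> 2 * cmod w" if "k \<in> {1..n}" for k w
    using agent_bounds(1-3)[OF A excess_le1[OF that] \<alpha> magnitude_le] by auto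
  have bd2: "(Re (cnj (u k) * w))\<^sup>2 \<le> 4 * (cmod w)\<^sup>2" "(Im (cnj (u k) * w))\<^sup>2 \<le> 4 * (cmod w)\<^sup>2" if "k \<in> {1..n}" for k w
    using power_mono[OF bd(2)[OF that], of w 2] power_mono[OF bd(3)[OF that], of w 2] 
    by (simp_all add: power_mult_distrib del: times_complex.sel)
  have "G \<le> (\<Sum>k=1..n. 2 * (Re (cnj (u k) * s k))\<^sup>2 + 8 * (cmod (s k - x))\<^sup>2)"
    unfolding d
  proof (rule sum_mono)
    fix k assume k: "k \<in> {1..n}"
    have "Re (cnj (u k) * x) = Re (cnj (u k) * s k) + - Re (cnj (u k) * (s k - x))" by (simp add: algebra_simps)
    then have "(Re (cnj (u k) * x))\<^sup>2 \<le> 2 * (Re (cnj (u k) * s k))\<^sup>2 + 2 * (Re (cnj (u k) * (s k - x)))\<^sup>2"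
      using sq2[of "Re (cnj (u k) * s k)" "- Re (cnj (u k) * (s k - x))"] by (simp del: times_complex.sel)
    with bd2(1)[OF k, of "s k - x"] show "(Re (cnj (u k) * x))\<^sup>2 \<le> 2 * (Re (cnj (u k) * s k))\<^sup>2 + 8 * (cmod (s k - x))\<^sup>2"
      by linarith
  qed
  also have "\<dots> = 2 * P + 8 * D" by (simp add: d sum.distrib sum_distrib_left)
  finally have G: "G \<le> 2 * P + 8 * D" .
  have "S \<le> (\<Sum>k=1..n. 2 * (cmod (s k - x))\<^sup>2 + 2 * (cmod x)\<^sup>2)"
    unfolding d
  proof (rule sum_mono)
    fix k
    have "cmod (s k) \<le> cmod (s k - x) + cmod x" using norm_triangle_ineq[of "s k - x" x] by simp
    then have "(cmod (s k))\<^sup>2 \<le> (cmod (s k - x) + cmod x)\<^sup>2" by (intro power_mono) auto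
    with sq2[of "cmod (s k - x)" "cmod x"] show "(cmod (s k))\<^sup>2 \<le> 2 * (cmod (s k - x))\<^sup>2 + 2 * (cmod x)\<^sup>2" by linarith
  qed
  also have "\<dots> = 2 * D + 2 * (real n * (cmod x)\<^sup>2)" by (simp add: d sum.distrib sum_distrib_left)
  finally have S: "S \<le> 2 * D + 2 * (real n * (cmod x)\<^sup>2)" .
  have "\<kappa> * (real n * (cmod x)\<^sup>2) = (1 / 16) * ((cmod x)\<^sup>2 / (4 * real n))"
    using n by (simp add: \<kappa>_def field_simps power2_eq_square)
  also have "\<dots> \<le> (1 / 16) * G" unfolding d using mean_noncollinear by simp
  finally have X: "\<kappa> * (real n * (cmod x)\<^sup>2) \<le> G / 16" by simp
  have "\<kappa> * S \<le> 2 * (\<kappa> * D) + 2 * (\<kappa> * (real n * (cmod x)\<^sup>2))"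
    using mult_left_mono[OF S, of \<kappa>] \<kappa> by (simp add: distrib_left)
  moreover have "\<kappa> * D \<le> (1 / 2) * D" using \<kappa> pos by (intro mult_right_mono) auto
  ultimately have 1: "(\<kappa> / 2) * S \<le> P + D" using X G pos by (simp add: field_simps)
  have "R \<le> (\<Sum>k=1..n. 2 * A\<^sup>2 * (skew A (u k) (s k))\<^sup>2 + 8 * A\<^sup>2 * (cmod (s k))\<^sup>2)"
    unfolding d
  proof (rule sum_mono)
    fix k assume k: "k \<in> {1..n}"
    have "excess (u k) = A * (- skew A (u k) (s k) + Im (cnj (u k) * s k))" using A by (simp add: skew_def field_simps)
    then have "(excess (u k))\<^sup>2 = A\<^sup>2 * (- skew A (u k) (s k) + Im (cnj (u k) * s k))\<^sup>2" by (simp only: power_mult_distrib)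
    also have "\<dots> \<le> A\<^sup>2 * (2 * (skew A (u k) (s k))\<^sup>2 + 2 * (4 * (cmod (s k))\<^sup>2))"
      using sq2[of "- skew A (u k) (s k)" "Im (cnj (u k) * s k)"] bd2(2)[OF k, of "s k"]
      by (intro mult_left_mono) (simp_all del: times_complex.sel)
    finally show "(excess (u k))\<^sup>2 \<le> 2 * A\<^sup>2 * (skew A (u k) (s k))\<^sup>2 + 8 * A\<^sup>2 * (cmod (s k))\<^sup>2" 
      by (simp add: algebra_simps)
  qed
  also have "\<dots> = 2 * A\<^sup>2 * Y + 8 * A\<^sup>2 * S" by (simp add: d sum.distrib sum_distrib_left)
  also have "\<dots> \<le> 2 * \<alpha>\<^sup>2 * Y + 8 * \<alpha>\<^sup>2 * S"
    using A \<alpha> pos by (intro add_mono mult_right_mono mult_left_mono power_mono) auto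
  finally have R: "R \<le> \<alpha>\<^sup>2 * (2 * Y + 8 * S)" by (simp add: algebra_simps)
  have \<alpha>2: "\<alpha>\<^sup>2 \<ge> 1" using one_le_power[of \<alpha> 2] \<alpha> by simp
  define e where "e = \<kappa> / 32"
  have e: "e > 0" "e \<le> 1 / 64" using \<kappa> by (simp_all add: e_def)
  have c: "8 * coercivity n \<alpha> = e / \<alpha>\<^sup>2" using n \<alpha> by (simp add: coercivity_def \<kappa>_def e_def field_simps)
  have "(e / \<alpha>\<^sup>2) * R \<le> (e / \<alpha>\<^sup>2) * (\<alpha>\<^sup>2 * (2 * Y + 8 * S))"
    using R e \<alpha>2 by (intro mult_left_mono) auto
  also have "\<dots> = 2 * (e * Y) + 8 * (e * S)" using \<alpha> by (simp add: field_simps)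
  finally have "(e / \<alpha>\<^sup>2) * R \<le> 2 * (e * Y) + 8 * (e * S)" .
  moreover have "e / \<alpha>\<^sup>2 \<le> e / 1" using e \<alpha>2 by (intro divide_left_mono) auto
  then have "(e / \<alpha>\<^sup>2) * S \<le> e * S" using pos by (intro mult_right_mono) auto
  moreover have "e * Y \<le> 1 / 64 * Y" using e pos by (intro mult_right_mono) auto
  moreover have "16 * (e * S) = \<kappa> / 2 * S" by (simp add: e_def)
  moreover have "e * S \<ge> 0" using e pos by simp
  ultimately have "8 * coercivity n \<alpha> * (R + S) \<le> P + D + Y"
    unfolding c distrib_left using pos 1 by linarith
  then show ?thesis
    by (simp add: d deviation_def sum.distrib add_ac)
qed

lemma lyap_sum_bounds:
  assumes small: "\<nu> \<le> 2 * coercivity n \<alpha>" "156 * \<alpha> * \<mu> \<le> coercivity n \<alpha> / 2"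
  shows "coercivity n \<alpha> * deviation n u s \<le> (\<Sum>k=1..n. lyap A \<mu> (u k) (s k) x)"
    and "(\<Sum>k=1..n. lyap A \<mu> (u k) (s k) x) \<le> 168 * \<alpha>\<^sup>2 * deviation n u s"
proof -
  define C where "C k = \<mu> ^ 6 * (skew A (u k) (s k) * defect (u k) (s k) x) + \<mu> ^ 8 * (excess (u k) * Re (cnj (u k) * x))
    - \<mu> ^ 10 * (defect (u k) (s k) x * excess (u k))" for k
  have C: "\<bar>C k\<bar> \<le> 26 * \<alpha> * \<mu> * (magnitude k)\<^sup>2" if "k \<in> {1..n}" for k
    unfolding C_def by (rule cross_terms_le[OF A \<mu> excess_le1[OF that] \<alpha> magnitude_le])
  have d0: "deviation n u s \<ge> 0" by (simp add: deviation_def sum_nonneg)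
  have Csum: "(\<Sum>k=1..n. C k) \<le> 156 * \<alpha> * \<mu> * deviation n u s"
  proof -
    have "(\<Sum>k=1..n. C k) \<le> (\<Sum>k=1..n. 26 * \<alpha> * \<mu> * (magnitude k)\<^sup>2)"
      by (intro sum_mono) (use C in force)
    also have "\<dots> \<le> 26 * \<alpha> * \<mu> * (6 * deviation n u s)"
      unfolding sum_distrib_left[symmetric] using magnitude_sums(1) \<alpha> \<mu> by (intro mult_left_mono) auto
    finally show ?thesis by simp
  qed
  have cub: "(\<Sum>k=1..n. excess (u k) * (cmod (s k))\<^sup>2) \<le> \<nu> * deviation n u s"
  proof -
    have "(\<Sum>k=1..n. excess (u k) * (cmod (s k))\<^sup>2) \<le> (\<Sum>k=1..n. \<nu> * ((excess (u k))\<^sup>2 + (cmod (s k))\<^sup>2))"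
      using near(1) \<nu> by (intro sum_mono mult_mono) (auto dest!: abs_le_D1)
    then show ?thesis by (simp add: deviation_def sum_distrib_left)
  qed
  have eq: "(\<Sum>k=1..n. lyap A \<mu> (u k) (s k) x) = 
      (\<Sum>k=1..n. (Re (cnj (u k) * s k))\<^sup>2 + (skew A (u k) (s k))\<^sup>2 + (cmod (s k - x))\<^sup>2) / 4
      - (\<Sum>k=1..n. excess (u k) * (cmod (s k))\<^sup>2) / 4 - (\<Sum>k=1..n. C k)"
    unfolding lyap_sum_eq C_def[symmetric] by (simp add: sum_subtractf diff_divide_distrib flip: sum_divide_distrib del: times_complex.sel)
  have "\<nu> * deviation n u s \<le> 2 * coercivity n \<alpha> * deviation n u s" "156 * \<alpha> * \<mu> * deviation n u s \<le> coercivity n \<alpha> / 2 * deviation n u s"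
    using small d0 by (intro mult_right_mono; simp)+
  then show "coercivity n \<alpha> * deviation n u s \<le> (\<Sum>k=1..n. lyap A \<mu> (u k) (s k) x)"
    using energy_lower Csum cub unfolding eq by simp
  have "(\<Sum>k=1..n. lyap A \<mu> (u k) (s k) x) \<le> (\<Sum>k=1..n. 28 * \<alpha>\<^sup>2 * (magnitude k)\<^sup>2)"
  proof (rule sum_mono)
    fix k assume k: "k \<in> {1..n}"
    define a where "a = magnitude k"
    have a: "\<bar>excess (u k)\<bar> \<le> a" "cmod (s k) \<le> a" "cmod x \<le> a" using magnitude_le unfolding a_def by auto
    have a0: "a \<ge> 0" using a(2) norm_ge_zero[of "s k"] by linarith
    have \<alpha>2: "\<alpha> \<le> \<alpha>\<^sup>2" "1 \<le> \<alpha>\<^sup>2" 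
      using \<alpha>(1) power_increasing[of 1 2 \<alpha>] one_le_power[of \<alpha> 2] by simp_all
    define Z where "Z = \<alpha>\<^sup>2 * a\<^sup>2"
    have Z: "a\<^sup>2 \<le> Z" "\<alpha> * a\<^sup>2 \<le> Z" "Z \<ge> 0"
      unfolding Z_def using mult_right_mono[OF \<alpha>2(1), of "a\<^sup>2"] mult_right_mono[OF \<alpha>2(2), of "a\<^sup>2"] a0 by simp_all
    have q: "\<bar>Im (cnj (u k) * s k)\<bar> \<le> 2 * a"
      by (rule order_trans[OF agent_bounds(3)[OF A excess_le1[OF k] \<alpha> a]]) (use a in simp)
    have s2: "(cmod (s k))\<^sup>2 \<le> a\<^sup>2" using a by (intro power_mono) auto
    have A1: "\<bar>1 / A\<bar> \<le> \<alpha>" using A \<alpha> by simp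
    define t1 t2 where "t1 = excess (u k) * (1 / A) * (excess (u k) * (1 / A))" "t2 = excess (u k) * (1 / A) * Im (cnj (u k) * s k)"
    note t = this
    have t1: "\<bar>t1\<bar> \<le> a * \<alpha> * (a * \<alpha>)" and t2: "\<bar>t2\<bar> \<le> a * \<alpha> * (2 * a)"
      unfolding t by (intro abs_mult_le a A1 q)+
    have e: "a * \<alpha> * (a * \<alpha>) = Z" "a * \<alpha> * (2 * a) = 2 * (\<alpha> * a\<^sup>2)" by (simp_all add: Z_def power2_eq_square)
    have "26 * \<alpha> * \<mu> * a\<^sup>2 \<le> 26 * \<alpha> * 1 * a\<^sup>2" using \<mu> \<alpha> by (intro mult_right_mono mult_left_mono) auto
    then have c: "\<bar>C k\<bar> \<le> 26 * (\<alpha> * a\<^sup>2)" using C[OF k] unfolding a_def by simp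
    have "lyap A \<mu> (u k) (s k) x = (cmod (s k))\<^sup>2 / 2 - (cmod x)\<^sup>2 / 4 + t1 / 4 - t2 / 2 - C k"
      unfolding lyap_def C_def t using A by (simp add: field_simps power2_eq_square del: times_complex.sel)
    then have "lyap A \<mu> (u k) (s k) x \<le> 28 * Z"
      using t1 t2 c Z s2 zero_le_power2[of "cmod x"] unfolding e by linarith
    then show "lyap A \<mu> (u k) (s k) x \<le> 28 * \<alpha>\<^sup>2 * (magnitude k)\<^sup>2" by (simp add: Z_def a_def)
  qed
  also have "\<dots> \<le> 28 * \<alpha>\<^sup>2 * (6 * deviation n u s)"
    unfolding sum_distrib_left[symmetric] using magnitude_sums(1) by (intro mult_left_mono) auto
  finally show "(\<Sum>k=1..n. lyap A \<mu> (u k) (s k) x) \<le> 168 * \<alpha>\<^sup>2 * deviation n u s" by simp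
qed

end

section \<open>Exponential decay and exponential convergence\<close>
lemma nonincreasing_from_0:
  fixes f :: "real \<Rightarrow> real"
  assumes d: "\<And>t. t \<ge> 0 \<Longrightarrow> (f has_real_derivative f' t) (at t within {0..})"
    and neg: "\<And>t. 0 \<le> t \<Longrightarrow> t \<le> T \<Longrightarrow> f' t \<le> 0" and T: "T \<ge> 0"
  shows "f T \<le> f 0"
proof (rule DERIV_nonpos_imp_decreasing_open[OF T])
  fix t assume t: "0 < t" "t < T"
  have "at t within {0..} = at t" using t by (intro at_within_interior) auto
  with d[of t] neg[of t] t show "\<exists>y. (f has_real_derivative y) (at t) \<and> y \<le> 0" by auto
next
  have "continuous_on {0..} f"
    using d by (auto simp: continuous_on_eq_continuous_within intro: DERIV_continuous)
  then show "continuous_on {0..T} f" by (rule continuous_on_subset) auto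
qed

text \<open>The estimates on \<open>V\<close> are required only while \<open>D \<le> r\<close>; the smallness of \<open>D 0\<close> makes this region
  invariant.\<close>
lemma lyapunov_exponential_decay:
  fixes V V' D :: "real \<Rightarrow> real"
  assumes V: "\<And>t. t \<ge> 0 \<Longrightarrow> (V has_real_derivative V' t) (at t within {0..})"
    and D: "continuous_on {0..} D"
    and lower: "\<And>t. t \<ge> 0 \<Longrightarrow> D t \<le> r \<Longrightarrow> w * D t \<le> V t"
    and upper: "\<And>t. t \<ge> 0 \<Longrightarrow> D t \<le> r \<Longrightarrow> V t \<le> C * D t"
    and decay: "\<And>t. t \<ge> 0 \<Longrightarrow> D t \<le> r \<Longrightarrow> V' t \<le> - (l * D t)"
    and pos: "w > 0" "C > 0" "l > 0" "\<And>t. D t \<ge> 0"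
    and start: "C * D 0 < w * r" "D 0 < r"
  shows "\<forall>t\<ge>0. D t < r \<and> D t \<le> (V 0 / w) * exp (- (l / C) * t)"
proof -
  have V0: "V 0 < w * r" using upper[of 0] start by simp
  have small: "D t < r" if t: "t \<ge> 0" for t
  proof (rule ccontr)
    assume "\<not> D t < r"
    then have Dt: "D t \<ge> r" by simp
    have cont: "continuous_on {0..b} D" for b by (rule continuous_on_subset[OF D]) auto
    define S where "S = {z \<in> {0..t}. D z = r}"
    \<comment> \<open>Consider the first time at which \<open>D\<close> reaches the level \<open>r\<close>.\<close>
    have "\<exists>z\<ge>0. z \<le> t \<and> D z = r"
      by (rule IVT') (use start Dt t cont in auto)
    then have "S \<noteq> {}" by (auto simp: S_def)
    moreover have "compact S" unfolding compact_eq_bounded_closed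
    proof
      show "bounded S" by (rule bounded_subset[of "{0..t}"]) (auto simp: S_def)
      show "closed S" unfolding S_def
        by (rule continuous_closed_preimage_constant[OF cont]) simp
    qed
    ultimately have "\<exists>T\<in>S. \<forall>z\<in>S. T \<le> z" by (intro compact_attains_inf)
    then obtain T where T: "T \<in> S" "\<And>z. z \<in> S \<Longrightarrow> T \<le> z" by blast
    have T': "0 \<le> T" "T \<le> t" "D T = r" using T(1) by (auto simp: S_def)
    have le: "D z \<le> r" if z: "0 \<le> z" "z \<le> T" for z
    proof (rule ccontr)
      assume "\<not> D z \<le> r"
      then have "\<exists>y\<ge>0. y \<le> z \<and> D y = r"
        by (intro IVT') (use start z cont in auto)
      then obtain y where y: "0 \<le> y" "y \<le> z" "D y = r" by blast
      then have "y \<in> S" using z T' by (auto simp: S_def)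
      with T(2) y z have "z = y" by force
      with y \<open>\<not> D z \<le> r\<close> show False by simp
    qed
    have "V T \<le> V 0"
    proof (rule nonincreasing_from_0[OF V _ T'(1)])
      fix z assume z: "0 \<le> z" "z \<le> T"
      have "l * D z \<ge> 0" using pos by simp
      with decay[of z] le[OF z] z show "V' z \<le> 0" by linarith
    qed
    with lower[of T] T' V0 show False by simp
  qed
  have "D t \<le> (V 0 / w) * exp (- (l / C) * t)" if t: "t \<ge> 0" for t
  proof -
    \<comment> \<open>Gronwall: \<open>V\<close> times the reciprocal exponential is nonincreasing.\<close>
    define g where "g z = V z * exp ((l / C) * z)" for z
    have "g t \<le> g 0"
    proof (rule nonincreasing_from_0[OF _ _ t])
      fix z :: real assume z: "0 \<le> z"
      show "(g has_real_derivative (V' z + (l / C) * V z) * exp ((l / C) * z)) (at z within {0..})"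
        unfolding g_def[abs_def]
        by (rule derivative_eq_intros V z refl)+ (simp add: algebra_simps)
    next
      fix z :: real assume z: "0 \<le> z"
      have Dz: "D z \<le> r" using small[OF z] by simp
      have "(l / C) * V z \<le> (l / C) * (C * D z)" 
        using pos upper[OF z Dz] by (intro mult_left_mono) auto
      also have "\<dots> = l * D z" using pos by simp
      finally have "V' z + (l / C) * V z \<le> 0" using decay[OF z Dz] by linarith
      then show "(V' z + (l / C) * V z) * exp ((l / C) * z) \<le> 0" by (intro mult_nonpos_nonneg) auto
    qed
    then have "V t * exp ((l / C) * t) \<le> V 0" by (simp add: g_def)
    moreover have "w * D t * exp ((l / C) * t) \<le> V t * exp ((l / C) * t)"
      using lower[OF t] small[OF t] by (intro mult_right_mono) auto
    ultimately have "w * D t * exp ((l / C) * t) \<le> V 0" by linarith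
    then show ?thesis using pos by (simp add: exp_minus field_simps)
  qed
  with small show ?thesis by blast
qed

lemma exponentially_convergent:
  fixes f :: "real \<Rightarrow> complex"
  assumes d: "\<And>t. t \<ge> 0 \<Longrightarrow> (f has_vector_derivative f' t) (at t within {0..})"
    and bd: "\<And>t. t \<ge> 0 \<Longrightarrow> cmod (f' t) \<le> C * exp (- \<eta> * t)" and \<eta>: "\<eta> > 0"
  shows "\<exists>L. (f \<longlongrightarrow> L) at_top \<and> (\<forall>t\<ge>0. cmod (f t - L) \<le> C / \<eta> * exp (- \<eta> * t))"
proof -
  have C: "C \<ge> 0" using order_trans[OF norm_ge_zero bd[of 0]] by simp
  define \<phi> where "\<phi> t = - (C / \<eta>) * exp (- \<eta> * t)" for t
  have cont: "continuous_on {0..} f"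
    using d by (auto simp: continuous_on_eq_continuous_within intro: has_vector_derivative_continuous)
  have diff: "cmod (f b - f a) \<le> C / \<eta> * exp (- \<eta> * a)" if ab: "0 \<le> a" "a \<le> b" for a b
  proof (cases "a = b")
    case False
    have "norm (f b - f a) \<le> \<phi> b - \<phi> a"
    proof (rule differentiable_bound_general)
      show "a < b" using ab False by simp
      show "continuous_on {a..b} f" by (rule continuous_on_subset[OF cont]) (use ab in auto)
      show "continuous_on {a..b} \<phi>" unfolding \<phi>_def by (intro continuous_intros)
      fix t assume t: "a < t" "t < b"
      have "at t within {0..} = at t" using t ab by (intro at_within_interior) auto
      with d[of t] t ab show "(f has_vector_derivative f' t) (at t)" by auto
      have "(\<phi> has_real_derivative C * exp (- \<eta> * t)) (at t)" 
        unfolding \<phi>_def[abs_def] by (rule derivative_eq_intros refl)+ (use \<eta> in simp)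
      then show "(\<phi> has_vector_derivative C * exp (- \<eta> * t)) (at t)" 
        by (simp add: has_real_derivative_iff_has_vector_derivative)
      show "norm (f' t) \<le> C * exp (- \<eta> * t)" using bd t ab by simp
    qed
    also have "\<dots> \<le> C / \<eta> * exp (- \<eta> * a)" using C \<eta> by (simp add: \<phi>_def)
    finally show ?thesis .
  qed (use C \<eta> in simp)
  have to0: "((\<lambda>t. C / \<eta> * exp (- \<eta> * t)) \<longlongrightarrow> 0) at_top"
    using \<eta> by real_asymp
  have "Cauchy (\<lambda>m. f (real m))"
  proof (rule metric_CauchyI)
    fix e :: real assume "e > 0"
    have "(\<lambda>m. C / \<eta> * exp (- \<eta> * real m)) \<longlonglongrightarrow> 0"
      by (rule filterlim_compose[OF to0 filterlim_real_sequentially])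
    from order_tendstoD(2)[OF this, of "e / 2"] \<open>e > 0\<close>
    obtain M where M: "C / \<eta> * exp (- \<eta> * real M) < e / 2" 
      by (auto simp: eventually_sequentially)
    show "\<exists>M. \<forall>m\<ge>M. \<forall>n\<ge>M. dist (f (real m)) (f (real n)) < e"
    proof (intro exI allI impI)
      fix m n assume mn: "m \<ge> M" "n \<ge> M"
      have "dist (f (real m)) (f (real M)) < e / 2" if "m \<ge> M" for m
        unfolding dist_norm by (rule le_less_trans[OF diff M]) (use that in auto)
      with mn have "dist (f (real m)) (f (real M)) < e / 2" "dist (f (real n)) (f (real M)) < e / 2"
        by blast+
      then show "dist (f (real m)) (f (real n)) < e" by (rule dist_triangle_half_l)
    qed
  qed
  then obtain L where L: "(\<lambda>m. f (real m)) \<longlonglongrightarrow> L" using Cauchy_convergent convergent_def by blast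
  have le: "cmod (f t - L) \<le> C / \<eta> * exp (- \<eta> * t)" if t: "t \<ge> 0" for t
  proof (rule tendsto_upperbound)
    show "(\<lambda>m. cmod (f t - f (real m))) \<longlonglongrightarrow> cmod (f t - L)" by (intro tendsto_intros L)
    show "\<forall>\<^sub>F m in sequentially. cmod (f t - f (real m)) \<le> C / \<eta> * exp (- \<eta> * t)"
    proof (rule eventually_sequentiallyI[of "nat \<lceil>t\<rceil>"])
      fix m assume "nat \<lceil>t\<rceil> \<le> m"
      then have "t \<le> real m" by linarith
      from diff[OF t this] show "cmod (f t - f (real m)) \<le> C / \<eta> * exp (- \<eta> * t)" by (simp add: norm_minus_commute)
    qed
  qed simp
  have "(f \<longlongrightarrow> L) at_top"
  proof (rule Lim_null_comparison[THEN LIM_zero_cancel, OF _ to0])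
    show "\<forall>\<^sub>F t in at_top. norm (f t - L) \<le> C / \<eta> * exp (- \<eta> * t)"
      using eventually_ge_at_top[of 0] by eventually_elim (rule le)
  qed
  with le show ?thesis by blast
qed

section \<open>The flow in the rotating frame\<close>

text \<open>Solutions of the equations of motion in the rotating frame for \<open>t \<ge> 0\<close>; derivatives are one-sided
  at 0.\<close>
locale rotating_flow =
  fixes n :: nat and A :: real and u s :: "nat \<Rightarrow> real \<Rightarrow> complex"
  assumes n: "n \<ge> 1" and odd: "odd n" and A: "A > 0"
    and du: "\<And>k t. k \<in> {1..n} \<Longrightarrow> t \<ge> 0 \<Longrightarrow> (u k has_vector_derivative
        - complex_of_real (excess (u k t)) * u k t - \<i> * of_real A * s k t) (at t within {0..})"
    and ds: "\<And>k t. k \<in> {1..n} \<Longrightarrow> t \<ge> 0 \<Longrightarrow> (s k has_vector_derivative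
        - complex_of_real (excess (u k t)) * u k t - 2 * \<i> * of_real A * s k t
        + \<i> * of_real A * ((\<Sum>k=1..n. s k t) / of_nat n)) (at t within {0..})"
    and sum_eq: "\<And>t. t \<ge> 0 \<Longrightarrow> (\<Sum>k=1..n. u k t) = (\<Sum>k=1..n. s k t)"
begin

text \<open>The mean of the \<open>s k\<close>, which is also the mean of the \<open>u k\<close>, and the mean of the \<open>\<rho> k * u k\<close>.\<close>
definition x where "x t = (\<Sum>k=1..n. s k t) / of_nat n"
definition B where "B t = (\<Sum>k=1..n. of_real (excess (u k t)) * u k t) / of_nat n"

lemma dx: 
  assumes "t \<ge> 0"
  shows "(x has_vector_derivative - B t - \<i> * of_real A * x t) (at t within {0..})"
proof -
  have "((\<lambda>t. (\<Sum>k=1..n. s k t) / of_nat n) has_vector_derivative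
      (\<Sum>k=1..n. - complex_of_real (excess (u k t)) * u k t - 2 * \<i> * of_real A * s k t + \<i> * of_real A * x t) / of_nat n)
      (at t within {0..})"
    unfolding x_def by (intro has_vector_derivative_divide has_vector_derivative_sum ds assms)
  moreover have "(\<Sum>k=1..n. - complex_of_real (excess (u k t)) * u k t - 2 * \<i> * of_real A * s k t + \<i> * of_real A * x t) / of_nat n
     = - B t - \<i> * of_real A * x t"
    using n unfolding sum.distrib sum_subtractf mult_minus_left sum_negf sum_distrib_left[symmetric] sum_constant
    by (simp add: x_def B_def field_simps)
  ultimately show ?thesis unfolding x_def[abs_def] by simp
qed

lemma mean_state: "mean_state n (\<lambda>k. u k t) (\<lambda>k. s k t) (x t) (B t)"
  using n by unfold_locales (auto simp: x_def B_def)

lemma dlyap: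
  assumes "t \<ge> 0"
  shows "((\<lambda>t. \<Sum>k=1..n. lyap A \<mu> (u k t) (s k t) (x t)) has_real_derivative
      (\<Sum>k=1..n. lyap_rate A \<mu> (u k t) (s k t) (x t) (B t))) (at t within {0..})"
  by (intro DERIV_sum lyap_deriv dx A assms)
    (use du ds assms in \<open>auto simp: x_def\<close>)

lemma continuous_deviation: "continuous_on {0..} (\<lambda>t. deviation n (\<lambda>k. u k t) (\<lambda>k. s k t))"
proof -
  have "continuous_on {0..} (u k)" "continuous_on {0..} (s k)" if "k \<in> {1..n}" for k
    using du[OF that] ds[OF that] 
    by (auto simp: continuous_on_eq_continuous_within intro: has_vector_derivative_continuous)
  then show ?thesis
    unfolding deviation_def excess_def by (intro continuous_intros) auto
qed

end

text \<open>The rate \<open>\<eta>\<close> and the threshold \<open>d\<close> depend on \<open>n\<close> and \<open>A\<close> only. The factor 2 in the exponent is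
  there because the deviation is a squared quantity.\<close>
lemma rotating_flow_decay:
  fixes n :: nat and A :: real
  assumes n: "n \<ge> 1" "odd n" and A: "A > 0"
  obtains \<eta> d where "\<eta> > 0" "0 < d"
    "\<And>u s. rotating_flow n A u s \<Longrightarrow> deviation n (\<lambda>k. u k 0) (\<lambda>k. s k 0) < d \<Longrightarrow>
      \<exists>K. \<forall>t\<ge>0. deviation n (\<lambda>k. u k t) (\<lambda>k. s k t) \<le> 1 \<and> deviation n (\<lambda>k. u k t) (\<lambda>k. s k t) \<le> K * exp (- (2 * \<eta>) * t)"
proof -
  define \<alpha> where "\<alpha> = max 1 (max A (1 / A))"
  have \<alpha>: "\<alpha> \<ge> 1" "\<alpha> \<ge> A" "\<alpha> \<ge> 1 / A" by (auto simp: \<alpha>_def)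
  define c w where "c = contraction n A" "w = coercivity n \<alpha>"
  note cw = this
  have c: "c > 0" using n A by (simp add: cw contraction_def)
  have w: "w > 0" using n \<alpha> by (simp add: cw coercivity_def)
  \<comment> \<open>\<open>\<mu>\<close> is chosen first, so that cross terms are negligible; then \<open>\<nu>\<close>, so that cubic terms are.\<close>
  define \<mu> where "\<mu> = min 1 (min (c / (186 * \<alpha>\<^sup>2)) (w / (312 * \<alpha>)))"
  have \<mu>: "0 < \<mu>" "\<mu> \<le> 1" "\<mu> \<le> c / (186 * \<alpha>\<^sup>2)" "\<mu> \<le> w / (312 * \<alpha>)" using c w \<alpha> by (auto simp: \<mu>_def)
  have \<mu>c: "93 * \<alpha>\<^sup>2 * \<mu> \<le> c / 2" and \<mu>w: "156 * \<alpha> * \<mu> \<le> w / 2"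
    using \<mu>(3,4) \<alpha> by (simp_all add: field_simps)
  define l where "l = c * \<mu> ^ 10 / (20 * \<alpha>\<^sup>2)"
  have l: "l > 0" using c \<mu> \<alpha> by (simp add: l_def)
  define \<nu> where "\<nu> = min (1 / (4 * real n)) (min (2 * w) (l / (2000 * \<alpha>\<^sup>2)))"
  have \<nu>: "0 < \<nu>" "\<nu> \<le> 1 / (4 * real n)" "\<nu> \<le> 2 * w" "\<nu> \<le> l / (2000 * \<alpha>\<^sup>2)" 
    using n w l \<alpha> by (auto simp: \<nu>_def)
  note \<nu>3 = \<nu>(3)
  have \<nu>l: "2000 * \<alpha>\<^sup>2 * \<nu> \<le> l" using \<nu>(4) \<alpha> by (simp add: field_simps)
  define C where "C = 168 * \<alpha>\<^sup>2"
  have C: "C > 0" using \<alpha> by (simp add: C_def)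
  define d where "d = min (\<nu>\<^sup>2) (w * \<nu>\<^sup>2 / C)"
  have "1 / (4 * real n) \<le> 1" using n by simp
  then have \<nu>1: "\<nu>\<^sup>2 \<le> 1" using \<nu> by (intro power_le_one) auto
  show thesis
  proof
    show "l / (2 * C) > 0" using l C by simp
    show "0 < d" using \<nu> w C by (simp add: d_def)
    fix u s assume "rotating_flow n A u s" and d0: "deviation n (\<lambda>k. u k 0) (\<lambda>k. s k 0) < d"
    then interpret rotating_flow n A u s by simp
    define D where "D t = deviation n (\<lambda>k. u k t) (\<lambda>k. s k t)" for t
    define V where "V t = (\<Sum>k=1..n. lyap A \<mu> (u k t) (s k t) (x t))" for t
    define V' where "V' t = (\<Sum>k=1..n. lyap_rate A \<mu> (u k t) (s k t) (x t) (B t))" for t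
    have near: "near_state n (\<lambda>k. u k t) (\<lambda>k. s k t) (x t) (B t) A \<alpha> \<mu> \<nu>"
      if t: "t \<ge> 0" and D: "D t \<le> \<nu>\<^sup>2" for t
    proof -
      have "(excess (u k t))\<^sup>2 \<le> \<nu>\<^sup>2" "(cmod (s k t))\<^sup>2 \<le> \<nu>\<^sup>2" if k: "k \<in> {1..n}" for k
      proof -
        have "(excess (u k t))\<^sup>2 + (cmod (s k t))\<^sup>2 \<le> D t"
          unfolding D_def deviation_def using k by (intro member_le_sum) auto
        with D show "(excess (u k t))\<^sup>2 \<le> \<nu>\<^sup>2" "(cmod (s k t))\<^sup>2 \<le> \<nu>\<^sup>2"
          using zero_le_power2[of "excess (u k t)"] zero_le_power2[of "cmod (s k t)"] by linarith+
      qed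
      then have b: "\<bar>excess (u k t)\<bar> \<le> \<nu>" "cmod (s k t) \<le> \<nu>" if "k \<in> {1..n}" for k
        using that \<nu>(1) by (auto simp: power2_le_iff_abs_le dest: power2_le_imp_le)
      interpret mean_state n "\<lambda>k. u k t" "\<lambda>k. s k t" "x t" "B t" by (rule mean_state)
      show ?thesis by unfold_locales (use A odd sum_eq[OF t] \<mu> \<alpha> \<nu> b in auto)
    qed
    have "\<forall>t\<ge>0. D t < \<nu>\<^sup>2 \<and> D t \<le> (V 0 / w) * exp (- (l / C) * t)"
    proof (rule lyapunov_exponential_decay)
      show "(V has_real_derivative V' t) (at t within {0..})" if "t \<ge> 0" for t
        unfolding V_def V'_def by (rule dlyap[OF that])
      show "continuous_on {0..} D" unfolding D_def by (rule continuous_deviation)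
      fix t assume t: "0 \<le> t" "D t \<le> \<nu>\<^sup>2"
      interpret near_state n "\<lambda>k. u k t" "\<lambda>k. s k t" "x t" "B t" A \<alpha> \<mu> \<nu> by (rule near[OF t])
      show "w * D t \<le> V t" "V t \<le> C * D t"
        using lyap_sum_bounds \<nu>3 \<mu>w unfolding V_def D_def C_def cw by auto
      have "V' t \<le> (2000 * \<alpha>\<^sup>2 * \<nu> - c * \<mu> ^ 10 / (10 * \<alpha>\<^sup>2)) * D t"
        using lyap_rate_sum_le \<mu>c unfolding V'_def D_def cw by auto
      also have "\<dots> \<le> - l * D t"
      proof (rule mult_right_mono)
        have "c * \<mu> ^ 10 / (10 * \<alpha>\<^sup>2) = 2 * l" by (simp add: l_def)
        with \<nu>l show "2000 * \<alpha>\<^sup>2 * \<nu> - c * \<mu> ^ 10 / (10 * \<alpha>\<^sup>2) \<le> - l" by linarith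
        show "0 \<le> D t" by (simp add: D_def deviation_def sum_nonneg)
      qed
      finally show "V' t \<le> - (l * D t)" by simp
    next
      show "D t \<ge> 0" for t by (simp add: D_def deviation_def sum_nonneg)
      show "D 0 < \<nu>\<^sup>2" using d0 by (simp add: D_def d_def)
      have "D 0 < w * \<nu>\<^sup>2 / C" using d0 by (simp add: D_def d_def)
      then show "C * D 0 < w * \<nu>\<^sup>2" using C by (simp add: field_simps)
    qed (use w C l in auto)
    moreover have "2 * (l / (2 * C)) = l / C" by simp
    ultimately show "\<exists>K. \<forall>t\<ge>0. deviation n (\<lambda>k. u k t) (\<lambda>k. s k t) \<le> 1 
        \<and> deviation n (\<lambda>k. u k t) (\<lambda>k. s k t) \<le> K * exp (- (2 * (l / (2 * C))) * t)"
      using \<nu>1 unfolding D_def by (intro exI[of _ "V 0 / w"]) force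
  qed
qed

text \<open>The passage to the rotating frame; \<open>s k = u k - z k\<close> with \<open>z k = A e^(-\<i>At) (r k - rbar)\<close>.\<close>
lemma swarm_rotating_flow:
  assumes n: "n \<ge> 1" "odd n" and A: "A > 0" and sol: "swarm_solution n A r v"
  defines "rbar \<equiv> \<lambda>t. (\<Sum>k=1..n. r k t) / of_nat n"
  defines "u \<equiv> \<lambda>k t. - \<i> * cis (- A * t) * v k t"
  defines "s \<equiv> \<lambda>k t. u k t - of_real A * cis (- A * t) * (r k t - rbar t)"
  shows "rotating_flow n A u s"
    and "\<And>t. t \<ge> 0 \<Longrightarrow> (rbar has_vector_derivative \<i> * cis (A * t) * ((\<Sum>k=1..n. s k t) / of_nat n)) (at t within {0..})"
proof -
  have n0: "of_nat n \<noteq> (0::complex)" using n by simp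
  have dr: "(r k has_vector_derivative v k t) (at t within {0..})"
    and dv: "(v k has_vector_derivative - of_real (excess (v k t)) * v k t - of_real (A\<^sup>2) * (r k t - rbar t)) (at t within {0..})"
    if "k \<in> {1..n}" "t \<ge> 0" for k t
  proof -
    show "(r k has_vector_derivative v k t) (at t within {0..})"
      using sol that by (simp add: swarm_solution_def)
    have "(v k has_vector_derivative complex_of_real (1 - (cmod (v k t))\<^sup>2) * v k t
          - complex_of_real (A\<^sup>2 / real n) * (\<Sum>m=1..n. r k t - r m t)) (at t within {0..})"
      using sol that by (simp add: swarm_solution_def)
    moreover have "complex_of_real (A\<^sup>2 / real n) * (\<Sum>m=1..n. r k t - r m t) = of_real (A\<^sup>2) * (r k t - rbar t)"
      using n0 by (simp add: rbar_def sum_subtractf field_simps)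
    moreover have "1 - (cmod (v k t))\<^sup>2 = - excess (v k t)" by (simp add: excess_def)
    ultimately show "(v k has_vector_derivative - of_real (excess (v k t)) * v k t - of_real (A\<^sup>2) * (r k t - rbar t)) (at t within {0..})"
      by simp
  qed
  have excess_u: "excess (u k t) = excess (v k t)" for k t by (simp add: excess_def u_def norm_mult)
  have cc: "cis (A * t) * (cis (- A * t) * w) = w" for t w by (simp add: mult.assoc[symmetric] cis_mult)
  have vu: "v k t = \<i> * cis (A * t) * u k t" for k t 
    using cc[of t "v k t"] by (simp add: u_def algebra_simps)
  have drbar: "(rbar has_vector_derivative (\<Sum>k=1..n. v k t) / of_nat n) (at t within {0..})" if "t \<ge> 0" for t
    unfolding rbar_def by (intro has_vector_derivative_divide has_vector_derivative_sum dr that)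
  have sum_us: "(\<Sum>k=1..n. u k t) = (\<Sum>k=1..n. s k t)" for t
    unfolding s_def by (simp only: sum_subtractf sum_distrib_left[symmetric]) (use n0 in \<open>simp add: rbar_def\<close>)
  have dcis: "((\<lambda>t. cis (- A * t)) has_vector_derivative - of_real A * \<i> * cis (- A * t)) (at t within {0..})" for t
    using has_vector_derivative_cis_mult[of "- A"] by simp
  have du: "(u k has_vector_derivative - complex_of_real (excess (u k t)) * u k t - \<i> * of_real A * s k t) (at t within {0..})"
    if "k \<in> {1..n}" "t \<ge> 0" for k t
  proof -
    have "(u k has_vector_derivative - \<i> * cis (- A * t) * (- of_real (excess (v k t)) * v k t - of_real (A\<^sup>2) * (r k t - rbar t))
        + - \<i> * (- of_real A * \<i> * cis (- A * t)) * v k t) (at t within {0..})"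
      unfolding u_def by (intro has_vector_derivative_mult has_vector_derivative_mult_right dcis dv that)
    then show ?thesis unfolding excess_u
      by (rule has_vector_derivative_eq_rhs) (simp add: s_def u_def algebra_simps power2_eq_square)
  qed
  have ds: "(s k has_vector_derivative - complex_of_real (excess (u k t)) * u k t - 2 * \<i> * of_real A * s k t
        + \<i> * of_real A * ((\<Sum>k=1..n. s k t) / of_nat n)) (at t within {0..})"
    if "k \<in> {1..n}" "t \<ge> 0" for k t
  proof -
    have "(s k has_vector_derivative (- complex_of_real (excess (u k t)) * u k t - \<i> * of_real A * s k t)
        - (of_real A * cis (- A * t) * (v k t - (\<Sum>k=1..n. v k t) / of_nat n)
          + of_real A * (- of_real A * \<i> * cis (- A * t)) * (r k t - rbar t))) (at t within {0..})"
      unfolding s_def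
      by (intro has_vector_derivative_mult has_vector_derivative_mult_right has_vector_derivative_diff dcis dr drbar that du[unfolded s_def])
    moreover have "cis (- A * t) * v k t = \<i> * u k t" for k by (simp add: u_def mult.assoc[symmetric])
    then have "of_real A * cis (- A * t) * (v k t - (\<Sum>k=1..n. v k t) / of_nat n) = of_real A * \<i> * (u k t - (\<Sum>k=1..n. u k t) / of_nat n)"
      by (simp add: right_diff_distrib sum_distrib_left mult.assoc)
    ultimately show ?thesis unfolding sum_us
      by (elim has_vector_derivative_eq_rhs) (simp add: s_def algebra_simps)
  qed
  show "rotating_flow n A u s"
    by unfold_locales (use n A du ds sum_us in auto)
  show "(rbar has_vector_derivative \<i> * cis (A * t) * ((\<Sum>k=1..n. s k t) / of_nat n)) (at t within {0..})" if "t \<ge> 0" for t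
    using drbar[OF that] unfolding vu sum_us[symmetric] by (simp add: sum_distrib_left)
qed

section \<open>Stability of rotating states\<close>
theorem mainTheorem3:
  fixes n :: nat and A :: real
  assumes "n \<ge> 3" and "odd n" and "A > 0"
  shows "\<exists>\<eta>>0. \<exists>\<delta>>0. \<forall>R\<^sub>0 \<theta>\<^sub>0 r v.
    balanced_angles n \<theta>\<^sub>0 \<longrightarrow> swarm_solution n A r v \<longrightarrow>
    (\<forall>k\<in>{1..n}. cmod (r k 0 - rotating_pos A R\<^sub>0 \<theta>\<^sub>0 k 0) < \<delta> \<and>
                 cmod (v k 0 - rotating_vel A \<theta>\<^sub>0 k 0) < \<delta>) \<longrightarrow>
    (\<exists>R' \<theta>' K. balanced_angles n \<theta>' \<and>
      (\<forall>k\<in>{1..n}. \<forall>t\<ge>0.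
        cmod (r k t - rotating_pos A R' \<theta>' k t)
          + cmod (v k t - rotating_vel A \<theta>' k t) \<le> K * exp (- \<eta> * t)))"
proof -
  have n: "n \<ge> 1" using assms by simp
  obtain \<eta> d where \<eta>: "\<eta> > 0" and d: "0 < d"
    and decay: "\<And>u s. rotating_flow n A u s \<Longrightarrow> deviation n (\<lambda>k. u k 0) (\<lambda>k. s k 0) < d \<Longrightarrow>
      \<exists>K. \<forall>t\<ge>0. deviation n (\<lambda>k. u k t) (\<lambda>k. s k t) \<le> 1 \<and> deviation n (\<lambda>k. u k t) (\<lambda>k. s k t) \<le> K * exp (- (2 * \<eta>) * t)"
    using rotating_flow_decay[OF n assms(2,3)] by blast
  \<comment> \<open>The initial deviation of each agent is at most \<open>b \<delta>^2\<close>: \<open>|\<rho>| \<le> 3\<delta>\<close> and \<open>|s| \<le> (1 + 2A)\<delta>\<close>.\<close>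
  define b where "b = 9 + (1 + 2 * A)\<^sup>2"
  have b: "b > 0" by (simp add: b_def add_pos_nonneg)
  define \<delta> where "\<delta> = min 1 (d / (2 * real n * b))"
  have \<delta>: "\<delta> > 0" "\<delta> \<le> 1" using d b n by (auto simp: \<delta>_def)
  have \<delta>d: "real n * (b * \<delta>\<^sup>2) < d"
  proof -
    have "\<delta>\<^sup>2 \<le> \<delta>" using \<delta> by (simp add: power2_eq_square mult_left_le)
    also have "\<dots> \<le> d / (2 * real n * b)" by (simp add: \<delta>_def)
    finally have "real n * b * \<delta>\<^sup>2 \<le> real n * b * (d / (2 * real n * b))" using b by (intro mult_left_mono) auto
    also have "\<dots> = d / 2" using n b by simp
    finally show ?thesis using d by (simp add: mult.assoc)
  qed
  show ?thesis
  proof (rule exI[of _ \<eta>], intro conjI \<eta>, rule exI[of _ \<delta>], intro conjI allI impI \<delta>(1))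
    fix R\<^sub>0 \<theta>\<^sub>0 r v
    assume bal: "balanced_angles n \<theta>\<^sub>0" and sol: "swarm_solution n A r v"
      and init: "\<forall>k\<in>{1..n}. cmod (r k 0 - rotating_pos A R\<^sub>0 \<theta>\<^sub>0 k 0) < \<delta> \<and> cmod (v k 0 - rotating_vel A \<theta>\<^sub>0 k 0) < \<delta>"
    define rbar where "rbar t = (\<Sum>k=1..n. r k t) / of_nat n" for t
    define u where "u k t = - \<i> * cis (- A * t) * v k t" for k t
    define s where "s k t = u k t - of_real A * cis (- A * t) * (r k t - rbar t)" for k t
    note flow = swarm_rotating_flow[OF n assms(2,3) sol, folded rbar_def, folded u_def, folded s_def]
    interpret rotating_flow n A u s by (rule flow(1))
    have cc: "cis (A * t) * (cis (- A * t) * w) = w" for t w by (simp add: mult.assoc[symmetric] cis_mult)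
    have vu: "v k t = \<i> * cis (A * t) * u k t" for k t 
      using cc[of t "v k t"] by (simp add: u_def algebra_simps)
    have rs: "r k t = rbar t + of_real (1 / A) * cis (A * t) * (u k t - s k t)" for k t
      using cc[of t "r k t - rbar t"] A by (simp add: s_def algebra_simps)
    define D where "D t = deviation n (\<lambda>k. u k t) (\<lambda>k. s k t)" for t
    have "D 0 < d"
    proof -
      define e where "e k = r k 0 - rotating_pos A R\<^sub>0 \<theta>\<^sub>0 k 0" for k
      define ebar where "ebar = (\<Sum>k=1..n. e k) / of_nat n"
      have e: "cmod (e k) \<le> \<delta>" if "k \<in> {1..n}" for k using init that by (auto simp: e_def less_imp_le)
      have "cmod (\<Sum>k=1..n. e k) \<le> (\<Sum>k=1..n. \<delta>)" by (rule sum_norm_le) (use e in auto)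
      then have ebar: "cmod ebar \<le> \<delta>" using n by (simp add: ebar_def norm_divide field_simps)
      have r0: "r k 0 = R\<^sub>0 + of_real (1 / A) * cis (\<theta>\<^sub>0 k) + e k" for k by (simp add: e_def rotating_pos_def)
      have "(\<Sum>k=1..n. r k 0) = of_nat n * R\<^sub>0 + of_real (1 / A) * (\<Sum>k=1..n. cis (\<theta>\<^sub>0 k)) + (\<Sum>k=1..n. e k)"
        unfolding r0 by (simp add: sum.distrib sum_distrib_left)
      also have "(\<Sum>k=1..n. cis (\<theta>\<^sub>0 k)) = 0" using bal by (simp add: balanced_angles_def)
      finally have rbar0: "rbar 0 = R\<^sub>0 + ebar" using n by (simp add: rbar_def ebar_def field_simps)
      have per: "(excess (u k 0))\<^sup>2 + (cmod (s k 0))\<^sup>2 \<le> b * \<delta>\<^sup>2" if k: "k \<in> {1..n}" for k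
      proof -
        define f where "f = u k 0 - cis (\<theta>\<^sub>0 k)"
        have "f = - \<i> * (v k 0 - rotating_vel A \<theta>\<^sub>0 k 0)"
          by (simp add: f_def u_def rotating_vel_def algebra_simps)
        then have f: "cmod f \<le> \<delta>" using init k by (simp add: norm_mult less_imp_le)
        have "cmod (u k 0) = cmod (cis (\<theta>\<^sub>0 k) + f)" by (simp add: f_def)
        then have u: "\<bar>cmod (u k 0) - 1\<bar> \<le> \<delta>" 
          using f norm_triangle_ineq[of "cis (\<theta>\<^sub>0 k)" f] norm_triangle_ineq2[of "cis (\<theta>\<^sub>0 k)" "- f"] by auto
        have "excess (u k 0) = (cmod (u k 0) - 1) * (cmod (u k 0) + 1)" by (simp add: excess_def power2_eq_square algebra_simps)
        also have "\<bar>\<dots>\<bar> \<le> \<delta> * 3" by (rule abs_mult_le[OF u]) (use u \<delta> in linarith)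
        finally have ex: "(excess (u k 0))\<^sup>2 \<le> (\<delta> * 3)\<^sup>2"
          using power_mono[of "\<bar>excess (u k 0)\<bar>" "\<delta> * 3" 2] by simp
        have "s k 0 = f - of_real A * (e k - ebar)"
          using A by (simp add: s_def f_def r0 rbar0 algebra_simps)
        then have "cmod (s k 0) \<le> cmod f + cmod (of_real A * (e k - ebar))" by (simp only: norm_triangle_ineq4)
        also have "cmod (of_real A * (e k - ebar)) \<le> A * (\<delta> + \<delta>)"
          using A e[OF k] ebar norm_triangle_ineq4[of "e k" ebar] by (simp add: norm_mult)
        finally have "cmod (s k 0) \<le> (1 + 2 * A) * \<delta>" using f by (simp add: algebra_simps)
        then have "(cmod (s k 0))\<^sup>2 \<le> ((1 + 2 * A) * \<delta>)\<^sup>2" by (intro power_mono) auto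
        moreover have "b * \<delta>\<^sup>2 = (\<delta> * 3)\<^sup>2 + ((1 + 2 * A) * \<delta>)\<^sup>2"
          unfolding b_def power_mult_distrib by (simp add: distrib_right)
        ultimately show ?thesis using ex by linarith
      qed
      have "D 0 \<le> (\<Sum>k=1..n. b * \<delta>\<^sup>2)" unfolding D_def deviation_def using per by (rule sum_mono)
      also have "\<dots> < d" using \<delta>d by simp
      finally show ?thesis .
    qed
    with decay[OF flow(1)] obtain K where D1: "\<And>t. t \<ge> 0 \<Longrightarrow> D t \<le> 1" 
       and DK: "\<And>t. t \<ge> 0 \<Longrightarrow> D t \<le> K * exp (- (2 * \<eta>) * t)"
      unfolding D_def by blast
    have K0: "K \<ge> 0" using DK[of 0] by (simp add: D_def deviation_def) (meson order_trans sum_nonneg zero_le_power2 add_nonneg_nonneg)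
    define E where "E t = sqrt K * exp (- \<eta> * t)" for t
    have E0: "E t \<ge> 0" for t using K0 by (simp add: E_def)
    have DE: "D t \<le> (E t)\<^sup>2" if "t \<ge> 0" for t
      using DK[OF that] K0 by (simp add: E_def power_mult_distrib flip: exp_double) (simp add: mult.assoc)
    have bnd: "\<bar>excess (u k t)\<bar> \<le> E t" "cmod (s k t) \<le> E t" "\<bar>excess (u k t)\<bar> \<le> 1" if k: "k \<in> {1..n}" and t: "t \<ge> 0" for k t
    proof -
      have "(excess (u k t))\<^sup>2 + (cmod (s k t))\<^sup>2 \<le> D t"
        unfolding D_def deviation_def using k by (intro member_le_sum) auto
      then have "(excess (u k t))\<^sup>2 \<le> (E t)\<^sup>2" "(cmod (s k t))\<^sup>2 \<le> (E t)\<^sup>2" "(excess (u k t))\<^sup>2 \<le> 1"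
        using zero_le_power2[of "excess (u k t)"] zero_le_power2[of "cmod (s k t)"] DE[OF t] D1[OF t] by linarith+
      then show "\<bar>excess (u k t)\<bar> \<le> E t" "cmod (s k t) \<le> E t" "\<bar>excess (u k t)\<bar> \<le> 1"
        using E0[of t] by (auto dest: power2_le_imp_le simp: power2_le_iff_abs_le abs_square_le_1)
    qed
    have xE: "cmod (x t) \<le> E t" if "t \<ge> 0" for t
    proof -
      have "cmod (\<Sum>k=1..n. s k t) \<le> (\<Sum>k=1..n. E t)" by (rule sum_norm_le) (use bnd that in auto)
      then show ?thesis using n by (simp add: x_def norm_divide field_simps)
    qed
    have E_lim: "(E \<longlongrightarrow> 0) at_top" unfolding E_def using \<eta> by real_asymp
    define Cu where "Cu = (2 + A) * sqrt K"
    \<comment> \<open>The derivative of \<open>u k\<close> is bounded by a multiple of the square root of the deviation.\<close>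
    have "\<exists>L. (u k \<longlongrightarrow> L) at_top \<and> (\<forall>t\<ge>0. cmod (u k t - L) \<le> Cu / \<eta> * exp (- \<eta> * t))"
      if k: "k \<in> {1..n}" for k
    proof (rule exponentially_convergent[OF du[OF k] _ \<eta>])
      fix t :: real assume t: "0 \<le> t"
      have "(cmod (u k t))\<^sup>2 \<le> 2\<^sup>2" using bnd(3)[OF k t] unfolding excess_def by simp
      then have u2: "cmod (u k t) \<le> 2" by (rule power2_le_imp_le) simp
      have "cmod (- complex_of_real (excess (u k t)) * u k t - \<i> * of_real A * s k t)
          \<le> cmod (complex_of_real (excess (u k t)) * u k t) + cmod (\<i> * of_real A * s k t)"
        using norm_triangle_ineq4[of "- complex_of_real (excess (u k t)) * u k t" "\<i> * of_real A * s k t"] by simp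
      also have "\<dots> = \<bar>excess (u k t)\<bar> * cmod (u k t) + A * cmod (s k t)" using A by (simp add: norm_mult)
      also have "\<dots> \<le> E t * 2 + A * E t"
        using A bnd(1,2)[OF k t] u2 E0 by (intro add_mono mult_mono) auto
      finally show "cmod (- complex_of_real (excess (u k t)) * u k t - \<i> * of_real A * s k t) \<le> Cu * exp (- \<eta> * t)"
        by (simp add: E_def Cu_def algebra_simps)
    qed
    then obtain U where U: "\<And>k. k \<in> {1..n} \<Longrightarrow> (u k \<longlongrightarrow> U k) at_top"
      and uU: "\<And>k t. k \<in> {1..n} \<Longrightarrow> t \<ge> 0 \<Longrightarrow> cmod (u k t - U k) \<le> Cu / \<eta> * exp (- \<eta> * t)"
      by metis
    have "\<exists>L. (rbar \<longlongrightarrow> L) at_top \<and> (\<forall>t\<ge>0. cmod (rbar t - L) \<le> sqrt K / \<eta> * exp (- \<eta> * t))"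
    proof (rule exponentially_convergent[OF _ _ \<eta>])
      fix t :: real assume t: "0 \<le> t"
      show "(rbar has_vector_derivative \<i> * cis (A * t) * x t) (at t within {0..})"
        using flow(2)[OF t] by (simp add: x_def)
      show "cmod (\<i> * cis (A * t) * x t) \<le> sqrt K * exp (- \<eta> * t)" 
        using xE[OF t] by (simp add: norm_mult E_def)
    qed
    then obtain R' where R': "\<And>t. t \<ge> 0 \<Longrightarrow> cmod (rbar t - R') \<le> sqrt K / \<eta> * exp (- \<eta> * t)" by blast
    have U1: "cis (Arg (U k)) = U k" if k: "k \<in> {1..n}" for k
    proof -
      have "((\<lambda>t. excess (u k t)) \<longlongrightarrow> 0) at_top"
        by (rule Lim_null_comparison[OF _ E_lim])
          (use eventually_ge_at_top[of 0] in eventually_elim, simp add: bnd(1)[OF k])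
      moreover have "((\<lambda>t. excess (u k t)) \<longlongrightarrow> excess (U k)) at_top"
        unfolding excess_def by (intro tendsto_intros U k)
      ultimately have "excess (U k) = 0" using tendsto_unique trivial_limit_at_top_linorder by blast
      then have "(cmod (U k))\<^sup>2 = 1\<^sup>2" by (simp add: excess_def)
      then have norm1: "cmod (U k) = 1" by (rule power2_eq_imp_eq) auto
      then have "U k \<noteq> 0" by auto
      then show ?thesis by (simp add: cis_Arg sgn_div_norm norm1)
    qed
    have "balanced_angles n (\<lambda>k. Arg (U k))"
    proof -
      have "((\<lambda>t. \<Sum>k=1..n. u k t) \<longlongrightarrow> (\<Sum>k=1..n. U k)) at_top" by (intro tendsto_sum U)
      moreover have "((\<lambda>t. \<Sum>k=1..n. u k t) \<longlongrightarrow> 0) at_top"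
      proof (rule Lim_null_comparison)
        show "((\<lambda>t. real n * E t) \<longlongrightarrow> 0) at_top" using tendsto_mult_left[OF E_lim, of "real n"] by simp
        show "\<forall>\<^sub>F t in at_top. norm (\<Sum>k=1..n. u k t) \<le> real n * E t"
          using eventually_ge_at_top[of 0]
        proof eventually_elim
          case (elim t)
          then have "(\<Sum>k=1..n. u k t) = of_nat n * x t" unfolding sum_eq[OF elim] using n by (simp add: x_def)
          with xE[OF elim] show ?case by (simp add: norm_mult mult_left_mono)
        qed
      qed
      ultimately have "(\<Sum>k=1..n. U k) = 0" using tendsto_unique trivial_limit_at_top_linorder by blast
      moreover have "(\<Sum>k=1..n. cis (Arg (U k))) = (\<Sum>k=1..n. U k)" by (rule sum.cong) (auto simp: U1)
      ultimately show ?thesis by (simp add: balanced_angles_def)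
    qed
    moreover define K' where "K' = sqrt K / \<eta> + (1 / A) * (Cu / \<eta> + sqrt K) + Cu / \<eta>"
    have "cmod (r k t - rotating_pos A R' (\<lambda>k. Arg (U k)) k t)
          + cmod (v k t - rotating_vel A (\<lambda>k. Arg (U k)) k t) \<le> K' * exp (- \<eta> * t)" if k: "k \<in> {1..n}" and t: "t \<ge> 0" for k t
    proof -
      have "v k t - rotating_vel A (\<lambda>k. Arg (U k)) k t = \<i> * cis (A * t) * (u k t - U k)"
        by (simp add: vu rotating_vel_def U1[OF k] algebra_simps)
      then have v: "cmod (v k t - rotating_vel A (\<lambda>k. Arg (U k)) k t) \<le> Cu / \<eta> * exp (- \<eta> * t)"
        using uU[OF k t] by (simp add: norm_mult)
      have "r k t - rotating_pos A R' (\<lambda>k. Arg (U k)) k t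
          = (rbar t - R') + of_real (1 / A) * cis (A * t) * ((u k t - U k) - s k t)"
        unfolding rotating_pos_def U1[OF k]
        by (subst rs) (simp add: algebra_simps add_divide_distrib diff_divide_distrib)
      then have "cmod (r k t - rotating_pos A R' (\<lambda>k. Arg (U k)) k t)
          \<le> cmod (rbar t - R') + cmod (of_real (1 / A) * cis (A * t) * ((u k t - U k) - s k t))"
        by (simp only: norm_triangle_ineq)
      also have "\<dots> = cmod (rbar t - R') + (1 / A) * cmod ((u k t - U k) - s k t)"
        using A by (simp add: norm_mult norm_divide)
      also have "\<dots> \<le> sqrt K / \<eta> * exp (- \<eta> * t) + (1 / A) * (Cu / \<eta> * exp (- \<eta> * t) + E t)"
        using A R'[OF t] norm_triangle_ineq4[of "u k t - U k" "s k t"] uU[OF k t] bnd(2)[OF k t]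
        by (intro add_mono mult_left_mono) auto
      finally show ?thesis using v by (simp add: K'_def E_def algebra_simps)
    qed
    ultimately show "\<exists>R' \<theta>' K. balanced_angles n \<theta>' \<and>
      (\<forall>k\<in>{1..n}. \<forall>t\<ge>0. cmod (r k t - rotating_pos A R' \<theta>' k t)
          + cmod (v k t - rotating_vel A \<theta>' k t) \<le> K * exp (- \<eta> * t))"
      by blast
  qed
qed

end
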